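(* (Hartmann–Tzeng product bound) Let $\mathbb E,\mathbb F,\mathbb K,\mathbb L,\sigma,\theta,m,\ell$ be as in the context. Let $\mathcal C_1\subseteq\mathbb F^\ell$ be a nonzero cyclic code with minimum Hamming distance $\mathrm d_{\mathrm H}$ whose generator polynomial belongs to $\mathbb E[x]$, and let $\mathcal C_2\subseteq\mathbb F^m$ be a nonzero skew-cyclic code (with respect to $\theta$) with minimum rank distance $\mathrm d_{\mathrm{rk}}$ over $\mathbb F/\mathbb E$. Let $b,\delta,r,t_1,t_2$ be integers with $r\ge0$, such that $\gcd(\ell m,t_1)=1$ and $\gcd(\ell m,t_2)<\delta$. Let $a\in\mathbb K$ be a primitive $\ell$-th root of unity and let $\beta$ be a normal element of $\mathbb L/\mathbb K$. If $$\{(a^{b+it_1+st_2},\sigma^{it_1+st_2}(\beta))\in\mathbb K\times\mathbb L^*:\ 0\le i\le\delta-2,\ 0\le s\le r\}\subseteq T^{\mathrm H}_{\mathcal C_1}\uplus T^{\mathrm{rk}}_{\mathcal C_2},$$ then $$\mathrm d_{\mathrm H}\ge\left\lceil\frac{\delta+r}{\mathrm d_{\mathrm{rk}}}\right\rceil\qquad\text{and}\qquad \mathrm d_{\mathrm{rk}}\ge\left\lceil\frac{\delta+r}{\mathrm d_{\mathrm H}}\right\rceil.$$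
   Context: Setting. $\mathbb K/\mathbb E$ and $\mathbb F/\mathbb E$ are field extensions (inside a common field) of finite degrees $h$ and $m$, with $\mathbb K\cap\mathbb F=\mathbb E$; $\mathbb L=\mathbb F\mathbb K$, with $[\mathbb L:\mathbb F]=h$ and $[\mathbb L:\mathbb K]=m$. $\mathbb L/\mathbb K$ is a cyclic Galois extension, $\sigma\in\mathrm{Gal}(\mathbb L/\mathbb K)$, and $\theta=\sigma|_{\mathbb F}$ is an automorphism of $\mathbb F$ of order $m$ with fixed field $\mathbb E$ (so $\sigma$ generates $\mathrm{Gal}(\mathbb L/\mathbb K)$). $\ell$ is a positive integer such that $x^\ell-1$ has $\ell$ pairwise distinct roots, all in $\mathbb K$; moreover $\ell$ is coprime to $\mathrm{char}(\mathbb K)$ and to $m$. An element $\beta\in\mathbb L$ is normal if $\beta,\sigma(\beta),\dots,\sigma^{m-1}(\beta)$ is a $\mathbb K$-basis of $\mathbb L$. Codes. Codes are $\mathbb F$-linear subspaces. The minimum Hamming (resp. rank) distance is the minimum over nonzero codewords of the Hamming weight (resp. of the rank weight $\mathrm{wt}_{\mathrm{rk}}(v)=\dim_{\mathbb E}\langle v_0,\dots,v_{m-1}\rangle_{\mathbb E}$). $\mathcal C_1\subseteq\mathbb F^\ell$ is cyclic if it is invariant under the cyclic shift; equivalently $\mu_{\mathrm H}(\mathcal C_1)$ is an ideal of $\mathbb F[x]/(x^\ell-1)$, where $\mu_{\mathrm H}(u_0,\dots,u_{\ell-1})=\sum_i u_ix^i$; a generator polynomial $f_1$ satisfies $\mu_{\mathrm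 H}(\mathcal C_1)=(f_1(x))$. $\mathcal C_2\subseteq\mathbb F^m$ is skew-cyclic if it is invariant under $(v_0,\dots,v_{m-1})\mapsto(\theta(v_{m-1}),\theta(v_0),\dots,\theta(v_{m-2}))$; equivalently $\nu_{\mathrm{rk}}(\mathcal C_2)$ is a left ideal of $\mathbb F[z;\theta]/(z^m-1)$ (skew polynomials with $z\alpha=\theta(\alpha)z$), where $\nu_{\mathrm{rk}}(v_0,\dots,v_{m-1})=\sum_jv_jz^j$; it is generated by some $f_2(z)$. Defining sets. $T^{\mathrm H}_{\mathcal C_1}=\{a: a^\ell=1,\ f_1(a)=0\}$, a subset of the set $X=\{a\in\mathbb K:a^\ell=1\}$. For $f(z)=\sum_jf_jz^j$ and $\beta\in\mathbb L^*$ let $\mathrm{Ev}^\sigma_\beta(f)=\sum_jf_j\sigma^j(\beta)\beta^{-1}$ (the remainder of right division of $f$ by $z-\sigma(\beta)\beta^{-1}$ in $\mathbb L[z;\sigma]$); $T^{\mathrm{rk}}_{\mathcal C_2}=\{\beta\in\mathbb L^*:\mathrm{Ev}^\sigma_\beta(f_2)=0\}$, a subset of $Y=\mathbb L^*$. For $A\subseteq X$, $B\subseteq Y$: $A\uplus B=(A\times Y)\cup(X\times B)=\{(x,y)\in X\times Y: x\in A\text{ or }y\in B\}$. *)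

theory Defs
  imports
    "Jordan_Normal_Form.Matrix"
    "HOL-Algebra.Elementary_Groups"
    "HOL-Algebra.Generated_Fields"
    "HOL-Algebra.Embedded_Algebras"
    "HOL-Algebra.Algebraic_Closure_Type"
    "HOL-Algebra.Bij"
begin

text \<open>
  The common overfield is a type of class field. Its subfields are sets, treated with the
  HOL-Algebra notions (\<open>subfield\<close>, \<open>dimension\<close>, \<open>Span\<close>, \<open>independent\<close>, \<open>generate_field\<close>)
  of the ring \<open>\<Omega>\<close> of that type.
\<close>

abbreviation Omega :: "'a::field ring"  (\<open>\<Omega>\<close>) where
  "\<Omega> \<equiv> ring_of_type_algebra"


section \<open>Field automorphisms and Galois groups\<close>

text \<open>As in \<open>BijGroup\<close>, automorphisms are extensional, i.e. \<open>undefined\<close> outside their field.\<close>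

definition field_aut_group :: "'a::field set \<Rightarrow> ('a \<Rightarrow> 'a) monoid" where
  "field_aut_group F = (BijGroup F)
     \<lparr>carrier := ring_hom (\<Omega>\<lparr>carrier := F\<rparr>) (\<Omega>\<lparr>carrier := F\<rparr>) \<inter> Bij F\<rparr>"

definition gal_group :: "'a::field set \<Rightarrow> 'a set \<Rightarrow> ('a \<Rightarrow> 'a) monoid" where
  "gal_group L K = (field_aut_group L)
     \<lparr>carrier := {\<tau> \<in> carrier (field_aut_group L). \<forall>x\<in>K. \<tau> x = x}\<rparr>"

text \<open>A finite extension is Galois if the fixed field of its automorphism group is the base field.\<close>

definition finite_galois_extension :: "'a::field set \<Rightarrow> 'a set \<Rightarrow> bool" where
  "finite_galois_extension L K \<longleftrightarrow>
     K \<subseteq> L \<and> ring.finite_dimension \<Omega> K L \<and>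
     {x \<in> L. \<forall>\<tau>\<in>carrier (gal_group L K). \<tau> x = x} = K"

definition cyclic_galois_extension :: "'a::field set \<Rightarrow> 'a set \<Rightarrow> bool" where
  "cyclic_galois_extension L K \<longleftrightarrow> finite_galois_extension L K \<and> cyclic_group (gal_group L K)"

text \<open>The list \<open>\<beta>, \<sigma>(\<beta>), \<dots>, \<sigma>\<^bsup>m-1\<^esup>(\<beta>)\<close> is a basis of \<open>L\<close> over \<open>K\<close>.\<close>

definition normal_element :: "'a::field set \<Rightarrow> 'a set \<Rightarrow> ('a \<Rightarrow> 'a) \<Rightarrow> nat \<Rightarrow> 'a \<Rightarrow> bool" where
  "normal_element L K \<sigma> m \<beta> \<longleftrightarrow> \<beta> \<in> L \<and>
     ring.independent \<Omega> K (map (\<lambda>j. (\<sigma> ^^ j) \<beta>) [0..<m]) \<and>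
     ring.Span \<Omega> K (map (\<lambda>j. (\<sigma> ^^ j) \<beta>) [0..<m]) = L"

definition primitive_root_of_unity :: "nat \<Rightarrow> 'a::field \<Rightarrow> bool" where
  "primitive_root_of_unity l a \<longleftrightarrow> a ^ l = 1 \<and> (\<forall>k. 0 < k \<and> k < l \<longrightarrow> a ^ k \<noteq> 1)"


section \<open>Codes\<close>

definition linear_code :: "'a::field set \<Rightarrow> nat \<Rightarrow> 'a vec set \<Rightarrow> bool" where
  "linear_code F n C \<longleftrightarrow>
     C \<subseteq> {v \<in> carrier_vec n. \<forall>i<n. v $ i \<in> F} \<and> 0\<^sub>v n \<in> C \<and>
     (\<forall>u\<in>C. \<forall>v\<in>C. u + v \<in> C) \<and> (\<forall>c\<in>F. \<forall>v\<in>C. c \<cdot>\<^sub>v v \<in> C)"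

definition hamming_weight :: "'a::field vec \<Rightarrow> nat" where
  "hamming_weight v = card {i. i < dim_vec v \<and> v $ i \<noteq> 0}"

definition rank_weight :: "'a::field set \<Rightarrow> 'a vec \<Rightarrow> nat" where
  "rank_weight E v = ring.dim \<Omega> E (ring.Span \<Omega> E (list_of_vec v))"

definition min_distance :: "('a::field vec \<Rightarrow> nat) \<Rightarrow> nat \<Rightarrow> 'a vec set \<Rightarrow> nat" where
  "min_distance wt n C = Inf (wt ` (C - {0\<^sub>v n}))"

definition skew_shift :: "('a::field \<Rightarrow> 'a) \<Rightarrow> 'a vec \<Rightarrow> 'a vec" where
  "skew_shift \<theta> v = vec (dim_vec v) (\<lambda>i. \<theta> (v $ ((i + dim_vec v - 1) mod dim_vec v)))"

definition cyclic_code :: "'a::field set \<Rightarrow> nat \<Rightarrow> 'a vec set \<Rightarrow> bool" where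
  "cyclic_code F n C \<longleftrightarrow> linear_code F n C \<and> (\<forall>v\<in>C. skew_shift (\<lambda>x. x) v \<in> C)"

definition skew_cyclic_code :: "'a::field set \<Rightarrow> ('a \<Rightarrow> 'a) \<Rightarrow> nat \<Rightarrow> 'a vec set \<Rightarrow> bool" where
  "skew_cyclic_code F \<theta> n C \<longleftrightarrow> linear_code F n C \<and> (\<forall>v\<in>C. skew_shift \<theta> v \<in> C)"


section \<open>Generator polynomials\<close>

definition polys_over :: "'a::field set \<Rightarrow> 'a poly set" where
  "polys_over F = {p. \<forall>i. Polynomial.coeff p i \<in> F}"

text \<open>The map \<open>\<mu>\<^sub>H\<close>, and also \<open>\<nu>\<^sub>r\<^sub>k\<close> on the coefficients of skew polynomials.\<close>

definition code_poly :: "'a::field vec \<Rightarrow> 'a poly" where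
  "code_poly v = (\<Sum>i<dim_vec v. Polynomial.monom (v $ i) i)"

text \<open>
  A skew polynomial, with coefficients written on the left of the powers of \<open>z\<close>, is represented
  by the ordinary polynomial with the same coefficients. Its product follows from
  \<open>z \<alpha> = \<theta>(\<alpha>) z\<close>.
\<close>

definition skew_mult :: "('a::field \<Rightarrow> 'a) \<Rightarrow> 'a poly \<Rightarrow> 'a poly \<Rightarrow> 'a poly" where
  "skew_mult \<theta> f g = (\<Sum>i\<le>Polynomial.degree f. \<Sum>j\<le>Polynomial.degree g.
     Polynomial.monom (Polynomial.coeff f i * (\<theta> ^^ i) (Polynomial.coeff g j)) (i + j))"

text \<open>
  Residue classes modulo \<open>x\<^sup>n - 1\<close> are represented by their unique member of degree below \<open>n\<close>,
  which is the form in which \<open>code_poly\<close> yields them. The right-hand sides below thus are the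
  ideal generated by \<open>f\<close> in \<open>F[x]/(x\<^sup>n - 1)\<close>, and the left ideal generated by \<open>f\<close> in
  \<open>F[z;\<theta>]/(z\<^sup>n - 1)\<close>.
\<close>

definition cyclic_generator :: "'a::field set \<Rightarrow> nat \<Rightarrow> 'a vec set \<Rightarrow> 'a poly \<Rightarrow> bool" where
  "cyclic_generator F n C f \<longleftrightarrow> f \<in> polys_over F \<and>
     code_poly ` C = {p. Polynomial.degree p < n \<and>
       (\<exists>g\<in>polys_over F. \<exists>h\<in>polys_over F. p = g * f + h * (Polynomial.monom 1 n - 1))}"

definition skew_cyclic_generator ::
    "'a::field set \<Rightarrow> ('a \<Rightarrow> 'a) \<Rightarrow> nat \<Rightarrow> 'a vec set \<Rightarrow> 'a poly \<Rightarrow> bool" where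
  "skew_cyclic_generator F \<theta> n C f \<longleftrightarrow> f \<in> polys_over F \<and>
     code_poly ` C = {p. Polynomial.degree p < n \<and>
       (\<exists>g\<in>polys_over F. \<exists>h\<in>polys_over F.
          p = skew_mult \<theta> g f + skew_mult \<theta> h (Polynomial.monom 1 n - 1))}"


section \<open>Defining sets\<close>

definition roots_of_unity_in :: "'a::field set \<Rightarrow> nat \<Rightarrow> 'a set" where
  "roots_of_unity_in K l = {x \<in> K. x ^ l = 1}"

definition hamming_defining_set :: "'a::field set \<Rightarrow> nat \<Rightarrow> 'a poly \<Rightarrow> 'a set" where
  "hamming_defining_set K l f = {x \<in> roots_of_unity_in K l. poly f x = 0}"

definition skew_eval :: "('a::field \<Rightarrow> 'a) \<Rightarrow> 'a \<Rightarrow> 'a poly \<Rightarrow> 'a" where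
  "skew_eval \<sigma> \<beta> f =
     (\<Sum>j\<le>Polynomial.degree f. Polynomial.coeff f j * (\<sigma> ^^ j) \<beta> * inverse \<beta>)"

definition rank_defining_set :: "'a::field set \<Rightarrow> ('a \<Rightarrow> 'a) \<Rightarrow> 'a poly \<Rightarrow> 'a set" where
  "rank_defining_set L \<sigma> f = {\<beta> \<in> L - {0}. skew_eval \<sigma> \<beta> f = 0}"

definition uplus_set :: "'a set \<Rightarrow> 'b set \<Rightarrow> 'a set \<Rightarrow> 'b set \<Rightarrow> ('a \<times> 'b) set" where
  "uplus_set U V A B = (A \<times> V) \<union> (U \<times> B)"

end

theory Submission
  imports Defs
begin

text \<open>
  Let \<open>c\<close> and \<open>v\<close> be words of minimum weight in the two codes, and let
  \<open>S(k) = c(a\<^sup>b\<^sup>+\<^sup>k) \<cdot> \<Sum>\<^sub>j v\<^sub>j \<sigma>\<^sup>j\<^sup>+\<^sup>k(\<beta>)\<close>. Writing the \<open>v\<^sub>j\<close> in a basis of their span over \<open>E\<close>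
  turns \<open>S\<close> into a combination of \<open>N\<close> sequences \<open>a\<^sup>u\<^sup>k \<sigma>\<^sup>k(\<gamma>)\<close>, where \<open>N\<close> is the product of the two
  distances; by hypothesis \<open>S\<close> vanishes on the Hartmann-Tzeng grid. For a suitable \<open>c\<^sub>0 \<noteq> 0\<close> the
  sequence \<open>\<sigma>\<^sup>t(S(k)) - c\<^sub>0 S(k + t)\<close> has fewer than \<open>N\<close> terms and vanishes on a grid that is shorter
  by one step in direction \<open>t\<close>. If \<open>N < \<delta> + r\<close>, induction shows that it is zero, so the zeros of
  \<open>S\<close> are invariant under \<open>t\<close>, and the gcd conditions yield \<open>S = 0\<close>. But \<open>a\<^sup>b\<^sup>+\<^sup>k\<close> depends on \<open>k\<close>
  modulo \<open>l\<close> and \<open>\<sigma>\<^sup>k\<close> on \<open>k\<close> modulo \<open>m\<close>, so by the Chinese remainder theorem some \<open>k\<close> makes both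
  factors nonzero.
\<close>


section \<open>Combinations of semilinear sequences\<close>

text \<open>The model for \<open>\<phi> i\<close> is \<open>a powi (u * k)\<close> times the
  \<open>k\<close>-th power of \<sigma> applied to a fixed element. Applying \<open>s t\<close>
  shifts the index by \<open>t\<close> up to a factor \<open>\<epsilon> i t\<close> that does not
  depend on \<open>k\<close>; this is what makes elimination of a term possible.\<close>

locale semilinear_sequences =
  fixes L :: "'a::field set"
    and s :: "int \<Rightarrow> 'a \<Rightarrow> 'a"
    and \<phi> \<epsilon> :: "'i \<Rightarrow> int \<Rightarrow> 'a"
    and n :: int
  assumes zero_closed: "0 \<in> L"
    and add_closed: "x \<in> L \<Longrightarrow> y \<in> L \<Longrightarrow> x + y \<in> L"
    and diff_closed: "x \<in> L \<Longrightarrow> y \<in> L \<Longrightarrow> x - y \<in> L"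
    and mult_closed: "x \<in> L \<Longrightarrow> y \<in> L \<Longrightarrow> x * y \<in> L"
    and inverse_closed: "x \<in> L \<Longrightarrow> inverse x \<in> L"
    and s_closed: "x \<in> L \<Longrightarrow> s t x \<in> L"
    and s_add: "x \<in> L \<Longrightarrow> y \<in> L \<Longrightarrow> s t (x + y) = s t x + s t y"
    and s_mult: "x \<in> L \<Longrightarrow> y \<in> L \<Longrightarrow> s t (x * y) = s t x * s t y"
    and s_eq_0: "x \<in> L \<Longrightarrow> s t x = 0 \<Longrightarrow> x = 0"
    and \<phi>_closed: "\<phi> i k \<in> L"
    and \<epsilon>_closed: "\<epsilon> i t \<in> L"
    and \<epsilon>_nonzero: "\<epsilon> i t \<noteq> 0"
    and s_\<phi>: "s t (\<phi> i k) = \<epsilon> i t * \<phi> i (k + t)"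
    and n_pos: "n > 0"
    and \<phi>_periodic: "\<phi> i (k + n) = \<phi> i k"
begin

definition comb :: "'i set \<Rightarrow> ('i \<Rightarrow> 'a) \<Rightarrow> int \<Rightarrow> 'a" where
  "comb I w k = (\<Sum>i\<in>I. w i * \<phi> i k)"

lemma s_0 [simp]: "s t 0 = 0"
  using s_add[OF zero_closed zero_closed, of t] by (metis add.right_neutral add_cancel_right_right)

lemma sum_closed: "(\<And>i. i \<in> I \<Longrightarrow> f i \<in> L) \<Longrightarrow> (\<Sum>i\<in>I. f i) \<in> L"
  by (induction I rule: infinite_finite_induct) (auto simp: zero_closed add_closed)

lemma s_sum: "(\<And>i. i \<in> I \<Longrightarrow> f i \<in> L) \<Longrightarrow> s t (\<Sum>i\<in>I. f i) = (\<Sum>i\<in>I. s t (f i))"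
  by (induction I rule: infinite_finite_induct) (auto simp: s_add sum_closed)

lemma comb_closed: "w \<in> I \<rightarrow> L \<Longrightarrow> comb I w k \<in> L"
  unfolding comb_def by (intro sum_closed mult_closed \<phi>_closed) auto

lemma comb_periodic: "comb I w (k + q * n) = comb I w k"
proof -
  have "\<phi> i (k + q * n) = \<phi> i k" for i
  proof (induction q rule: int_induct[where k = 0])
    case (step1 q)
    then show ?case using \<phi>_periodic[of i "k + q * n"] by (simp add: algebra_simps)
  next
    case (step2 q)
    then show ?case using \<phi>_periodic[of i "k + (q - 1) * n"] by (simp add: algebra_simps)
  qed simp
  then show ?thesis by (simp add: comb_def)
qed

section \<open>Elimination of a term and spreading of zeros\<close>

text \<open>Up to the period \<open>n\<close>, \<open>k\<close> lies on the line through
  \<open>k'\<close> in direction \<open>t\<close>.\<close>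

lemma comb_zero_dense:
  assumes "k - k' = x * t + q * n" and "\<And>j. comb I w (k' + j * t) = 0"
  shows "comb I w k = 0"
proof -
  have "k = (k' + x * t) + q * n" using assms(1) by simp
  then show ?thesis using assms(2)[of x] comb_periodic by metis
qed

text \<open>In \<open>s t (comb I w k)\<close> the coefficient of \<open>\<phi> i (k + t)\<close> is
  \<open>s t (w i) * \<epsilon> i t\<close>, again independent of \<open>k\<close>. Subtracting the
  multiple of the original combination that matches it at \<open>i0\<close> leaves one term
  fewer.\<close>

lemma comb_eliminate:
  assumes "finite I" "i0 \<in> I" and w: "w \<in> I \<rightarrow> L" and nz: "w i0 \<noteq> 0"
  obtains c \<mu> where "c \<noteq> 0" "\<mu> \<in> I - {i0} \<rightarrow> L"
    "\<And>k. s t (comb I w k) = c * comb I w (k + t) + comb (I - {i0}) \<mu> (k + t)"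
proof
  \<comment> \<open>The quotient of the new by the old coefficient at \<open>i0\<close>, so that
    \<open>\<mu> i0 = 0\<close>.\<close>
  define c where "c = s t (w i0) * \<epsilon> i0 t * inverse (w i0)"
  define \<mu> where "\<mu> = (\<lambda>i. s t (w i) * \<epsilon> i t - c * w i)"
  have cL: "c \<in> L" unfolding c_def
    using w assms(2) by (intro mult_closed s_closed \<epsilon>_closed inverse_closed) auto
  show "c \<noteq> 0" unfolding c_def
    using nz \<epsilon>_nonzero s_eq_0[of "w i0" t] w assms(2) by auto
  show "\<mu> \<in> I - {i0} \<rightarrow> L" unfolding \<mu>_def
    using w cL by (intro funcsetI diff_closed mult_closed s_closed \<epsilon>_closed) auto
  fix k
  have "s t (comb I w k) = (\<Sum>i\<in>I. s t (w i * \<phi> i k))"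
    unfolding comb_def by (rule s_sum) (use w in \<open>auto intro!: mult_closed \<phi>_closed\<close>)
  also have "\<dots> = (\<Sum>i\<in>I. c * (w i * \<phi> i (k + t)) + \<mu> i * \<phi> i (k + t))"
    by (rule sum.cong)
      (use w \<phi>_closed s_mult in \<open>auto simp: s_\<phi> \<mu>_def algebra_simps Pi_iff\<close>)
  also have "\<dots> = c * comb I w (k + t) + comb I \<mu> (k + t)"
    by (simp add: comb_def sum.distrib sum_distrib_left)
  also have "comb I \<mu> (k + t) = comb (I - {i0}) \<mu> (k + t)"
    unfolding comb_def using nz by (subst sum.remove[OF assms(1,2)]) (simp add: \<mu>_def c_def)
  finally show "s t (comb I w k) = c * comb I w (k + t) + comb (I - {i0}) \<mu> (k + t)" .
qed

text \<open>Without a remainder, zeros travel along \<open>t\<close> in both directions: forwards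
  because \<open>c \<noteq> 0\<close>, backwards because \<open>s t\<close> has trivial
  kernel.\<close>

lemma comb_propagate:
  assumes w: "w \<in> I \<rightarrow> L" and "c \<noteq> 0"
    and shift: "\<And>k. s t (comb I w k) = c * comb I w (k + t)"
    and "comb I w k = 0"
  shows "comb I w (k + j * t) = 0"
proof (induction j rule: int_induct[where k = 0])
  case base
  then show ?case using assms by simp
next
  case (step1 j)
  have "c * comb I w (k + j * t + t) = 0" using shift[of "k + j * t"] step1 by simp
  then show ?case using \<open>c \<noteq> 0\<close> by (simp add: algebra_simps)
next
  case (step2 j)
  have "s t (comb I w (k + (j - 1) * t)) = 0"
    using shift[of "k + (j - 1) * t"] step2 by (simp add: algebra_simps)
  then show ?case using s_eq_0 comb_closed[OF w] by blast
qed

text \<open>A semilinear form of the BCH argument. Elimination costs one term and one point of the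
  progression, so by induction the remainder is zero; then a single zero spreads along
  \<open>t\<close>, which is invertible modulo \<open>n\<close>.\<close>

lemma comb_zero_progression:
  assumes "finite I" and "w \<in> I \<rightarrow> L" and cop: "coprime t n"
    and "\<And>j. j < card I \<Longrightarrow> comb I w (k0 + int j * t) = 0"
  shows "comb I w k = 0"
  using assms(1,2,4)
proof (induction "card I" arbitrary: I w k0 k)
  case 0
  then show ?case by (simp add: comb_def)
next
  case (Suc N)
  show ?case
  proof (cases "\<forall>i\<in>I. w i = 0")
    case True
    then show ?thesis by (simp add: comb_def)
  next
    case False
    then obtain i0 where i0: "i0 \<in> I" "w i0 \<noteq> 0" by blast
    obtain c \<mu> where c: "c \<noteq> 0" and \<mu>: "\<mu> \<in> I - {i0} \<rightarrow> L"
      and e: "\<And>k. s t (comb I w k) = c * comb I w (k + t) + comb (I - {i0}) \<mu> (k + t)"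
      using comb_eliminate[OF Suc.prems(1) i0(1) Suc.prems(2) i0(2)] by blast
    have card: "N = card (I - {i0})" using Suc i0 by simp
    have \<mu>0: "comb (I - {i0}) \<mu> k = 0" for k
    proof (rule Suc.hyps(1)[OF card _ \<mu>, of "k0 + t"])
      fix j assume "j < card (I - {i0})"
      \<comment> \<open>The relation \<open>e\<close> at position \<open>j\<close> involves the
        values at \<open>j\<close> and \<open>j + 1\<close>; both are known zeros because the
        remainder has one term fewer.\<close>
      then have "j < card I" "Suc j < card I" using card Suc.hyps(2) by auto
      from this[THEN Suc.prems(3)] show "comb (I - {i0}) \<mu> (k0 + t + int j * t) = 0"
        using e[of "k0 + int j * t"] by (simp add: algebra_simps)
    qed (use Suc.prems in simp)
    have k0: "comb I w k0 = 0" using Suc.prems(3)[of 0] Suc.hyps(2) by simp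
    have all: "comb I w (k0 + j * t) = 0" for j
      by (rule comb_propagate[OF Suc.prems(2) c _ k0]) (simp add: e \<mu>0)
    obtain x q where "x * t + q * n = 1"
      using cop bezout_int[of t n] by (auto simp: coprime_iff_gcd_eq_1)
    then have "k - k0 = ((k - k0) * x) * t + ((k - k0) * q) * n"
      by (metis distrib_left mult.assoc mult.right_neutral)
    then show ?thesis by (rule comb_zero_dense) (rule all)
  qed
qed

text \<open>Here \<open>d\<close> stands for \<open>\<delta> - 1\<close>. Each elimination in
  direction \<open>t2\<close> trades one term for one row of the grid, until a single progression in
  direction \<open>t1\<close> is left. Going back, the zeros are invariant under \<open>t2\<close>,
  hence under \<open>gcd n t2\<close> up to the period, and the first row meets every residue class
  modulo that gcd.\<close>

lemma comb_zero_Hartmann_Tzeng: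
  assumes "finite I" and "w \<in> I \<rightarrow> L" and cop: "coprime t1 n"
    and g: "gcd n t2 \<le> int d" and "card I \<le> d + r"
    and "\<And>i j. i < d \<Longrightarrow> j \<le> r \<Longrightarrow> comb I w (k0 + int i * t1 + int j * t2) = 0"
  shows "comb I w k = 0"
  using assms(1,2,5,6)
proof (induction r arbitrary: I w k0 k)
  case 0
  show ?case
    by (rule comb_zero_progression[OF 0(1,2) cop, of k0]) (use 0(3) 0(4)[of _ 0] in simp)
next
  case (Suc r)
  show ?case
  proof (cases "\<forall>i\<in>I. w i = 0")
    case True
    then show ?thesis by (simp add: comb_def)
  next
    case False
    then obtain i0 where i0: "i0 \<in> I" "w i0 \<noteq> 0" by blast
    obtain c \<mu> where c: "c \<noteq> 0" and \<mu>: "\<mu> \<in> I - {i0} \<rightarrow> L"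
      and e: "\<And>k. s t2 (comb I w k) = c * comb I w (k + t2) + comb (I - {i0}) \<mu> (k + t2)"
      using comb_eliminate[OF Suc.prems(1) i0(1) Suc.prems(2) i0(2)] by blast
    have \<mu>0: "comb (I - {i0}) \<mu> k = 0" for k
    proof (rule Suc.IH[OF _ \<mu>, of "k0 + t2"])
      fix i j assume ij: "i < d" "j \<le> r"
      then have "j \<le> Suc r" "Suc j \<le> Suc r" by auto
      from this[THEN Suc.prems(4)[OF ij(1)]]
      show "comb (I - {i0}) \<mu> (k0 + t2 + int i * t1 + int j * t2) = 0"
        using e[of "k0 + int i * t1 + int j * t2"] by (simp add: algebra_simps)
    qed (use Suc.prems i0 in auto)
    \<comment> \<open>Each point of the first row yields zeros on its whole line in direction
      \<open>t2\<close>, for negative \<open>j\<close> too.\<close>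
    have all: "comb I w (k0 + int i * t1 + j * t2) = 0" if "i < d" for i j
      by (rule comb_propagate[OF Suc.prems(2) c])
        (use Suc.prems(4)[OF that, of 0] in \<open>simp_all add: e \<mu>0\<close>)
    define g where "g = gcd n t2"
    have gpos: "g > 0" using n_pos by (simp add: g_def)
    have "coprime t1 g" using cop unfolding g_def
      by (metis coprime_divisors dvd_refl gcd_dvd1)
    then obtain x z where x: "x * t1 + z * g = 1"
      using bezout_int[of t1 g] by (auto simp: coprime_iff_gcd_eq_1)
    \<comment> \<open>As \<open>x\<close> inverts \<open>t1\<close> modulo \<open>g\<close>, this
      makes \<open>i * t1\<close> congruent to \<open>k - k0\<close> modulo \<open>g\<close>. A
      remainder modulo \<open>g\<close> is below \<open>g\<close>, and \<open>g \<le> d\<close>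
      keeps it inside the row.\<close>
    define i where "i = nat (((k - k0) * x) mod g)"
    have i: "int i = ((k - k0) * x) mod g" using gpos by (simp add: i_def)
    have "i < d" using i pos_mod_bound[OF gpos, of "(k - k0) * x"] g g_def by linarith
    define y where "y = (k - k0) * z + ((k - k0) * x div g) * t1"
    have "k - k0 - int i * t1 = (k - k0) * (x * t1 + z * g) - int i * t1"
      by (simp add: x)
    also have "\<dots> = (k - k0) * z * g + ((k - k0) * x - int i) * t1"
      by (simp add: algebra_simps)
    also have "(k - k0) * x - int i = ((k - k0) * x div g) * g"
      by (simp add: i minus_mod_eq_div_mult)
    finally have y: "k - k0 - int i * t1 = y * g"
      by (simp add: y_def algebra_simps)
    \<comment> \<open>Multiples of \<open>g\<close> are multiples of \<open>t2\<close> modulo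
      \<open>n\<close>, so \<open>k\<close> lies on the line through the chosen row point.\<close>
    obtain u v where "u * n + v * t2 = g" using bezout_int[of n t2] g_def by auto
    then have "k - (k0 + int i * t1) = (y * v) * t2 + (y * u) * n"
      using y by (metis (no_types, lifting) add.commute diff_diff_eq distrib_left mult.assoc)
    then show ?thesis by (rule comb_zero_dense) (rule all[OF \<open>i < d\<close>])
  qed
qed

end


section \<open>Automorphisms of subfields\<close>

lemma ring_Omega: "ring (\<Omega> :: 'a::field ring)"
  and field_Omega: "field (\<Omega> :: 'a::field ring)"
  by (rule ring_from_type_algebra field_from_type_algebra)+

lemma Omega_simps [simp]:
  "carrier (\<Omega> :: 'a::field ring) = UNIV"
  "x \<oplus>\<^bsub>\<Omega>\<^esub> y = x + (y :: 'a)" "x \<otimes>\<^bsub>\<Omega>\<^esub> y = x * (y :: 'a)"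
  "\<zero>\<^bsub>\<Omega>\<^esub> = (0 :: 'a)" "\<one>\<^bsub>\<Omega>\<^esub> = (1 :: 'a)"
  by (simp_all add: ring_of_type_algebra_def)

lemma a_inv_Omega [simp]: "\<ominus>\<^bsub>\<Omega>\<^esub> x = - (x :: 'a::field)"
proof -
  interpret field "\<Omega> :: 'a ring" by (rule field_Omega)
  show ?thesis by (rule minus_equality) auto
qed

lemma m_inv_Omega: "x \<noteq> 0 \<Longrightarrow> inv\<^bsub>\<Omega>\<^esub> x = inverse (x :: 'a::field)"
proof -
  interpret field "\<Omega> :: 'a ring" by (rule field_Omega)
  assume "x \<noteq> 0"
  then show ?thesis by (intro comm_inv_char) auto
qed

lemma subfield_Omega_closed:
  fixes L :: "'a::field set"
  assumes "subfield L \<Omega>"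
  shows "0 \<in> L" "1 \<in> L" "x \<in> L \<Longrightarrow> y \<in> L \<Longrightarrow> x + y \<in> L"
    "x \<in> L \<Longrightarrow> y \<in> L \<Longrightarrow> x - y \<in> L" "x \<in> L \<Longrightarrow> y \<in> L \<Longrightarrow> x * y \<in> L"
    "x \<in> L \<Longrightarrow> inverse x \<in> L"
proof -
  interpret field "\<Omega> :: 'a ring" by (rule field_Omega)
  note sr = subfieldE(1)[OF assms]
  show "0 \<in> L" "1 \<in> L" using subringE(2,3)[OF sr] by auto
  show "x \<in> L \<Longrightarrow> y \<in> L \<Longrightarrow> x + y \<in> L" using subringE(7)[OF sr] by auto
  show "x \<in> L \<Longrightarrow> y \<in> L \<Longrightarrow> x * y \<in> L" using subringE(6)[OF sr] by auto
  show "x \<in> L \<Longrightarrow> y \<in> L \<Longrightarrow> x - y \<in> L"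
    using subringE(5,7)[OF sr] by (metis a_inv_Omega Omega_simps(2) uminus_add_conv_diff add.commute)
  show "x \<in> L \<Longrightarrow> inverse x \<in> L"
    using subfield_m_inv(1)[OF assms, of x] \<open>0 \<in> L\<close> m_inv_Omega[of x] by (cases "x = 0") auto
qed

lemma subfield_Omega_powi:
  assumes "subfield L \<Omega>" and "x \<in> L"
  shows "x powi k \<in> L"
proof -
  have "y ^ j \<in> L" if "y \<in> L" for y and j :: nat
    using that by (induction j) (auto intro: subfield_Omega_closed[OF assms(1)])
  then show ?thesis
    using assms(2) subfield_Omega_closed(6)[OF assms(1)] by (simp add: power_int_def)
qed

section \<open>Groups of field automorphisms and their powers\<close>

lemma restricted_BijGroup_mult:
  assumes "f \<in> Bij S" "g \<in> Bij S" "x \<in> S"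
  shows "(f \<otimes>\<^bsub>BijGroup S\<lparr>carrier := H\<rparr>\<^esub> g) x = f (g x)"
  using assms by (simp add: BijGroup_def compose_def)

text \<open>Group powers are extensional, whereas \<open>f ^^ j\<close> iterates a total function,
  so the two can be compared only on \<open>S\<close>.\<close>

lemma restricted_BijGroup_nat_pow:
  assumes "group (BijGroup S\<lparr>carrier := H\<rparr>)" "H \<subseteq> Bij S" "f \<in> H" "x \<in> S"
  shows "(f [^]\<^bsub>BijGroup S\<lparr>carrier := H\<rparr>\<^esub> (j::nat)) x = (f ^^ j) x"
  using assms(4)
proof (induction j arbitrary: x)
  case 0
  then show ?case by (simp add: nat_pow_def BijGroup_def)
next
  case (Suc j)
  let ?G = "BijGroup S\<lparr>carrier := H\<rparr>"
  interpret group ?G by (rule assms(1))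
  have f: "f \<in> Bij S" and fj: "f [^]\<^bsub>?G\<^esub> j \<in> Bij S"
    using assms(2,3) nat_pow_closed[of f j] by auto
  have "f x \<in> S" using Bij_imp_funcset[OF f] Suc.prems by auto
  then have "(f [^]\<^bsub>?G\<^esub> j \<otimes>\<^bsub>?G\<^esub> f) x = (f ^^ j) (f x)"
    using restricted_BijGroup_mult[OF fj f Suc.prems] Suc.IH by simp
  then show ?case by (simp add: funpow_swap1)
qed

lemma field_aut_groupD:
  assumes "f \<in> carrier (field_aut_group L)"
  shows "f \<in> Bij L" "x \<in> L \<Longrightarrow> f x \<in> L" "f 1 = 1"
    "x \<in> L \<Longrightarrow> y \<in> L \<Longrightarrow> f (x + y) = f x + f y"
    "x \<in> L \<Longrightarrow> y \<in> L \<Longrightarrow> f (x * y) = f x * f y"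
proof -
  have h: "f \<in> ring_hom (\<Omega>\<lparr>carrier := L\<rparr>) (\<Omega>\<lparr>carrier := L\<rparr>)" and "f \<in> Bij L"
    using assms by (auto simp: field_aut_group_def)
  then show "f \<in> Bij L" by simp
  show "x \<in> L \<Longrightarrow> f x \<in> L" using ring_hom_closed[OF h] by simp
  show "f 1 = 1" using ring_hom_one[OF h] by simp
  show "x \<in> L \<Longrightarrow> y \<in> L \<Longrightarrow> f (x + y) = f x + f y" using ring_hom_add[OF h] by simp
  show "x \<in> L \<Longrightarrow> y \<in> L \<Longrightarrow> f (x * y) = f x * f y" using ring_hom_mult[OF h] by simp
qed

lemma field_aut_groupI:
  assumes "f \<in> Bij L" "f 1 = 1"
    "\<And>x y. x \<in> L \<Longrightarrow> y \<in> L \<Longrightarrow> f (x + y) = f x + f y"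
    "\<And>x y. x \<in> L \<Longrightarrow> y \<in> L \<Longrightarrow> f (x * y) = f x * f y"
  shows "f \<in> carrier (field_aut_group L)"
  using assms Bij_imp_funcset[OF assms(1)]
  by (auto simp: field_aut_group_def intro!: ring_hom_memI)

text \<open>\<open>K\<close> is an arbitrary subset, so that \<open>K = {}\<close> covers the full
  automorphism group. Inverses respect both operations because the bijection itself does.\<close>

lemma subgroup_gal_group:
  assumes "subfield L \<Omega>" "K \<subseteq> L"
  shows "subgroup (carrier (gal_group L K)) (BijGroup L)"
proof -
  note L = subfield_Omega_closed[OF assms(1)]
  interpret B: group "BijGroup L" by (rule group_BijGroup)
  have gal: "f \<in> carrier (gal_group L K) \<longleftrightarrow>
      f \<in> carrier (field_aut_group L) \<and> (\<forall>x\<in>K. f x = x)" for f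
    by (simp add: gal_group_def)
  have one: "\<one>\<^bsub>BijGroup L\<^esub> = (\<lambda>x\<in>L. x)" by (simp add: BijGroup_def)
  have mult: "f \<otimes>\<^bsub>BijGroup L\<^esub> g = compose L f g"
    if "f \<in> Bij L" "g \<in> Bij L" for f g
    using that by (simp add: BijGroup_def)
  show ?thesis
  proof (rule subgroup.intro)
    show "carrier (gal_group L K) \<subseteq> carrier (BijGroup L)"
      using gal field_aut_groupD(1) by (auto simp: BijGroup_def)
  next
    fix f g assume "f \<in> carrier (gal_group L K)" "g \<in> carrier (gal_group L K)"
    then have f: "f \<in> carrier (field_aut_group L)" "\<forall>x\<in>K. f x = x"
      and g: "g \<in> carrier (field_aut_group L)" "\<forall>x\<in>K. g x = x" using gal by auto
    note f' = field_aut_groupD[OF f(1)] and g' = field_aut_groupD[OF g(1)]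
    have "compose L f g \<in> carrier (field_aut_group L)"
      by (rule field_aut_groupI) (use f' g' L in \<open>auto simp: compose_Bij compose_eq\<close>)
    then show "f \<otimes>\<^bsub>BijGroup L\<^esub> g \<in> carrier (gal_group L K)"
      using f g f' g' mult assms(2) by (auto simp: gal compose_eq subset_iff)
  next
    have "(\<lambda>x\<in>L. x) \<in> carrier (field_aut_group L)"
      by (rule field_aut_groupI) (use L in \<open>auto simp: id_Bij\<close>)
    then show "\<one>\<^bsub>BijGroup L\<^esub> \<in> carrier (gal_group L K)"
      using assms(2) by (auto simp: one gal)
  next
    fix f assume "f \<in> carrier (gal_group L K)"
    then have f: "f \<in> carrier (field_aut_group L)" "\<forall>x\<in>K. f x = x" using gal by auto
    note f' = field_aut_groupD[OF f(1)]
    have inj: "inj_on f L" using f'(1) by (auto simp: Bij_def bij_betw_def)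
    have inv_fixed: "inv_into L f x = x" if "x \<in> L" "f x = x" for x
      using inv_into_f_f[OF inj that(1)] that by simp
    have "restrict (inv_into L f) L \<in> carrier (field_aut_group L)"
    proof (rule field_aut_groupI)
      show "restrict (inv_into L f) L \<in> Bij L" by (rule restrict_inv_into_Bij[OF f'(1)])
      show "restrict (inv_into L f) L 1 = 1" using inv_fixed f'(3) L by simp
      show "restrict (inv_into L f) L (x + y) = restrict (inv_into L f) L x + restrict (inv_into L f) L y"
        if "x \<in> L" "y \<in> L" for x y
        using that L Bij_inv_into_lemma[where h = f and S = L and g = "(+)", OF f'(4) f'(1)] by simp
      show "restrict (inv_into L f) L (x * y) = restrict (inv_into L f) L x * restrict (inv_into L f) L y"
        if "x \<in> L" "y \<in> L" for x y
        using that L Bij_inv_into_lemma[where h = f and S = L and g = "(*)", OF f'(5) f'(1)] by simp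
    qed
    then show "inv\<^bsub>BijGroup L\<^esub> f \<in> carrier (gal_group L K)"
      using inv_fixed f(2) assms(2) by (auto simp: gal inv_BijGroup[OF f'(1)])
  qed
qed

lemma gal_group_eq: "gal_group L K = BijGroup L\<lparr>carrier := carrier (gal_group L K)\<rparr>"
  by (simp add: gal_group_def field_aut_group_def)

lemma field_aut_group_eq: "field_aut_group L = gal_group L {}"
  by (simp add: gal_group_def field_aut_group_def Int_def)

lemma group_gal_group:
  assumes "subfield L \<Omega>" "K \<subseteq> L"
  shows "group (gal_group L K)"
  by (metis gal_group_eq subgroup.subgroup_is_group[OF subgroup_gal_group[OF assms] group_BijGroup])

lemma gal_group_nat_pow:
  assumes "subfield L \<Omega>" "K \<subseteq> L" "\<sigma> \<in> carrier (gal_group L K)" "x \<in> L"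
  shows "(\<sigma> [^]\<^bsub>gal_group L K\<^esub> (j::nat)) x = (\<sigma> ^^ j) x"
proof -
  have "carrier (gal_group L K) \<subseteq> Bij L"
    using field_aut_groupD(1) by (auto simp: gal_group_def)
  then show ?thesis
    using restricted_BijGroup_nat_pow[OF _ _ assms(3,4)] group_gal_group[OF assms(1,2)]
    by (metis gal_group_eq)
qed

text \<open>Integer exponents are used because the steps of the grid may be negative.\<close>

lemma gal_group_int_pow_add:
  assumes "subfield L \<Omega>" "K \<subseteq> L" "\<sigma> \<in> carrier (gal_group L K)" "x \<in> L"
  shows "(\<sigma> [^]\<^bsub>gal_group L K\<^esub> (j + k :: int)) x
    = (\<sigma> [^]\<^bsub>gal_group L K\<^esub> j) ((\<sigma> [^]\<^bsub>gal_group L K\<^esub> k) x)"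
proof -
  interpret group "gal_group L K" by (rule group_gal_group[OF assms(1,2)])
  have "carrier (gal_group L K) \<subseteq> Bij L"
    using field_aut_groupD(1) by (auto simp: gal_group_def)
  then have "\<sigma> [^]\<^bsub>gal_group L K\<^esub> i \<in> Bij L" for i :: int
    using int_pow_closed[OF assms(3)] by auto
  then have "(\<sigma> [^]\<^bsub>gal_group L K\<^esub> j \<otimes>\<^bsub>gal_group L K\<^esub> \<sigma> [^]\<^bsub>gal_group L K\<^esub> k) x
      = (\<sigma> [^]\<^bsub>gal_group L K\<^esub> j) ((\<sigma> [^]\<^bsub>gal_group L K\<^esub> k) x)"
    using restricted_BijGroup_mult[OF _ _ assms(4)] gal_group_eq by metis
  then show ?thesis by (simp add: int_pow_mult[OF assms(3)])
qed

lemma subfield_Omega_sum: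
  "subfield L \<Omega> \<Longrightarrow> (\<And>i. i \<in> I \<Longrightarrow> f i \<in> L) \<Longrightarrow> (\<Sum>i\<in>I. f i) \<in> L"
  by (induction I rule: infinite_finite_induct) (auto intro: subfield_Omega_closed)


section \<open>Rank weight and evaluation of skew polynomials\<close>

lemma combine_Omega:
  "length ks = length us \<Longrightarrow>
     ring.combine \<Omega> ks us = (\<Sum>i<length us. ks ! i * (us ! i :: 'a::field))"
proof (induction ks us rule: list_induct2)
  case Nil
  then show ?case by (simp add: ring.combine.simps[OF ring_Omega])
next
  case (Cons k ks u us)
  then show ?case
    by (simp add: ring.combine.simps[OF ring_Omega] sum.lessThan_Suc_shift del: sum.lessThan_Suc)
qed

lemma Span_OmegaE:
  fixes E :: "'a::field set"
  assumes "subfield E \<Omega>" "x \<in> ring.Span \<Omega> E us"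
  obtains c where "\<And>i. c i \<in> E" "x = (\<Sum>i<length us. c i * us ! i)"
proof -
  interpret ring "\<Omega> :: 'a ring" by (rule ring_Omega)
  obtain ks where ks: "length ks = length us" "set ks \<subseteq> E" "x = combine ks us"
    using assms(2) Span_eq_combine_set_length_version[OF assms(1), of us] by auto
  \<comment> \<open>Padding with 0 makes \<open>c i \<in> E\<close> hold for every index.\<close>
  define c where "c i = (if i < length us then ks ! i else 0)" for i
  show thesis
  proof
    show "c i \<in> E" for i
      using ks(1,2) subfield_Omega_closed(1)[OF assms(1)] by (auto simp: c_def)
    show "x = (\<Sum>i<length us. c i * us ! i)"
      using ks(3) combine_Omega[OF ks(1)] by (simp add: c_def)
  qed
qed

text \<open>A rank factorization: \<open>A\<close> is a basis over \<open>E\<close> of the span of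
  the entries, so its length is the rank weight, and \<open>e\<close> holds the coordinates of the
  entries.\<close>

lemma rank_weight_decomposition:
  fixes v :: "'a::field vec"
  assumes "subfield E \<Omega>" "subfield F \<Omega>" "E \<subseteq> F" "\<And>i. i < dim_vec v \<Longrightarrow> v $ i \<in> F"
  obtains A e where "\<And>p. p < rank_weight E v \<Longrightarrow> A p \<in> F" "\<And>p j. e p j \<in> E"
    "\<And>j. j < dim_vec v \<Longrightarrow> v $ j = (\<Sum>p<rank_weight E v. e p j * A p)"
proof -
  interpret ring "\<Omega> :: 'a ring" by (rule ring_Omega)
  let ?S = "Span E (list_of_vec v)"
  have "dimension (dim E ?S) E ?S"
    using finite_dimensionE[OF assms(1) Span_finite_dimension[OF assms(1)]]
    by (simp add: over_def)
  then obtain us where us: "length us = rank_weight E v" "Span E us = ?S"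
    using exists_base[OF assms(1)] unfolding rank_weight_def by metis
  \<comment> \<open>The basis elements are combinations of entries of \<open>v\<close> over
    \<open>E\<close>, hence lie in \<open>F\<close>.\<close>
  have S_F: "x \<in> F" if x: "x \<in> ?S" for x
  proof -
    obtain c where c: "\<And>i. c i \<in> E" "x = (\<Sum>i<length (list_of_vec v). c i * list_of_vec v ! i)"
      using Span_OmegaE[OF assms(1) x] by blast
    have "c i * v $ i \<in> F" if "i < dim_vec v" for i
      using c(1) assms(3,4) that subfield_Omega_closed(5)[OF assms(2)] by blast
    then show ?thesis
      unfolding c(2) by (intro subfield_Omega_sum[OF assms(2)]) (auto simp: list_of_vec_index)
  qed
  have "\<exists>c. (\<forall>p. c p \<in> E) \<and> (j < dim_vec v \<longrightarrow> v $ j = (\<Sum>p<length us. c p * us ! p))" for j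
  proof (cases "j < dim_vec v")
    case True
    have "v $ j \<in> set (list_of_vec v)"
      using True by (metis length_list_of_vec list_of_vec_index nth_mem)
    then have "v $ j \<in> Span E us"
      using Span_base_incl[OF assms(1), of "list_of_vec v"] us(2) by auto
    then show ?thesis using Span_OmegaE[OF assms(1)] by metis
  next
    case False
    then show ?thesis
      using subfield_Omega_closed(1)[OF assms(1)] by (intro exI[of _ "\<lambda>_. 0"]) simp
  qed
  then obtain e where e: "\<And>p j. e j p \<in> E"
    "\<And>j. j < dim_vec v \<Longrightarrow> v $ j = (\<Sum>p<length us. e j p * us ! p)"
    by metis
  show thesis
  proof (rule that[of "\<lambda>p. us ! p" "\<lambda>p j. e j p"])
    show "us ! p \<in> F" if "p < rank_weight E v" for p
      using that us Span_base_incl[OF assms(1), of us] S_F by (auto simp: subset_iff)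
  qed (use e us in auto)
qed

section \<open>Skew polynomials as operators\<close>

lemma poly_code_poly: "poly (code_poly v) x = (\<Sum>i<dim_vec v. v $ i * x ^ i)"
  by (simp add: code_poly_def poly_sum poly_monom)

text \<open>The operator obtained by substituting \<sigma> for the variable. It is
  \<open>skew_eval\<close> without the division by the argument, which allows operators to be
  composed.\<close>

definition semilinear_eval :: "('a::field \<Rightarrow> 'a) \<Rightarrow> 'a poly \<Rightarrow> 'a \<Rightarrow> 'a" where
  "semilinear_eval \<sigma> p x = (\<Sum>j\<le>Polynomial.degree p. Polynomial.coeff p j * (\<sigma> ^^ j) x)"

lemma semilinear_eval_upto:
  assumes "Polynomial.degree p \<le> N"
  shows "semilinear_eval \<sigma> p x = (\<Sum>j\<le>N. Polynomial.coeff p j * (\<sigma> ^^ j) x)"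
  unfolding semilinear_eval_def
  by (rule sum.mono_neutral_left) (use assms in \<open>auto simp: Polynomial.coeff_eq_0\<close>)

lemma semilinear_eval_add:
  "semilinear_eval \<sigma> (p + q) x = semilinear_eval \<sigma> p x + semilinear_eval \<sigma> q x"
proof -
  let ?N = "max (Polynomial.degree p) (Polynomial.degree q)"
  have "Polynomial.degree (p + q) \<le> ?N" by (rule Polynomial.degree_add_le) auto
  then show ?thesis
    by (simp add: semilinear_eval_upto[of _ ?N] sum.distrib distrib_right)
qed

lemma semilinear_eval_0 [simp]: "semilinear_eval \<sigma> 0 x = 0"
  by (simp add: semilinear_eval_def)

lemma semilinear_eval_sum: "semilinear_eval \<sigma> (\<Sum>i\<in>I. p i) x = (\<Sum>i\<in>I. semilinear_eval \<sigma> (p i) x)"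
  by (induction I rule: infinite_finite_induct) (auto simp: semilinear_eval_add)

lemma semilinear_eval_monom [simp]:
  "semilinear_eval \<sigma> (Polynomial.monom c i) x = c * (\<sigma> ^^ i) x"
proof -
  have "semilinear_eval \<sigma> (Polynomial.monom c i) x
      = (\<Sum>j\<le>i. Polynomial.coeff (Polynomial.monom c i) j * (\<sigma> ^^ j) x)"
    by (rule semilinear_eval_upto) (rule Polynomial.degree_monom_le)
  also have "\<dots> = (\<Sum>j\<le>i. if j = i then c * (\<sigma> ^^ i) x else 0)"
    by (rule sum.cong) auto
  finally show ?thesis by simp
qed

lemma semilinear_eval_code_poly:
  "semilinear_eval \<sigma> (code_poly v) x = (\<Sum>j<dim_vec v. v $ j * (\<sigma> ^^ j) x)"
  by (simp add: code_poly_def semilinear_eval_sum)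

lemma funpow_eq_on:
  assumes "\<And>x. x \<in> F \<Longrightarrow> \<theta> x = \<sigma> x" "\<And>x. x \<in> F \<Longrightarrow> \<theta> x \<in> F" and "x \<in> F"
  shows "(\<theta> ^^ i) x = (\<sigma> ^^ i) x" "(\<theta> ^^ i) x \<in> F"
proof -
  show mem: "(\<theta> ^^ i) x \<in> F" for i
    using assms(2,3) by (induction i) simp_all
  show "(\<theta> ^^ i) x = (\<sigma> ^^ i) x"
  proof (induction i)
    case (Suc i)
    then show ?case using assms(1)[OF mem[of i]] by simp
  qed simp
qed

text \<open>Multiplying by \<alpha> and then applying \<sigma> is the same as applying \<sigma> and
  then multiplying by \<sigma>(\<alpha>), which mirrors the rule z \<alpha> = \<theta>(\<alpha>) z.
  The coefficients of the right factor are taken in \<open>F\<close>, where \<theta> and \<sigma>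
  agree.\<close>

lemma semilinear_eval_skew_mult:
  assumes L: "subfield L \<Omega>" and "F \<subseteq> L"
    and closed: "\<And>x. x \<in> L \<Longrightarrow> \<sigma> x \<in> L"
    and add: "\<And>x y. x \<in> L \<Longrightarrow> y \<in> L \<Longrightarrow> \<sigma> (x + y) = \<sigma> x + \<sigma> y"
    and mult: "\<And>x y. x \<in> L \<Longrightarrow> y \<in> L \<Longrightarrow> \<sigma> (x * y) = \<sigma> x * \<sigma> y"
    and \<theta>: "\<And>x. x \<in> F \<Longrightarrow> \<theta> x = \<sigma> x" "\<And>x. x \<in> F \<Longrightarrow> \<theta> x \<in> F"
    and "f \<in> polys_over F" "x \<in> L"
  shows "semilinear_eval \<sigma> (skew_mult \<theta> g f) x = semilinear_eval \<sigma> g (semilinear_eval \<sigma> f x)"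
proof -
  have pow_closed: "(\<sigma> ^^ i) y \<in> L" if "y \<in> L" for i y
    using that by (induction i) (auto intro: closed)
  have pow_add: "(\<sigma> ^^ i) (y + z) = (\<sigma> ^^ i) y + (\<sigma> ^^ i) z" if "y \<in> L" "z \<in> L" for i y z
    using that by (induction i) (auto simp: add pow_closed)
  have pow_mult: "(\<sigma> ^^ i) (y * z) = (\<sigma> ^^ i) y * (\<sigma> ^^ i) z" if "y \<in> L" "z \<in> L" for i y z
    using that by (induction i) (auto simp: mult pow_closed)
  have pow_0: "(\<sigma> ^^ i) 0 = 0" for i
    using pow_add[of 0 0 i] subfield_Omega_closed(1)[OF L]
    by (metis add.right_neutral add_cancel_right_right)
  have pow_sum: "(\<sigma> ^^ i) (\<Sum>j\<in>J. y j) = (\<Sum>j\<in>J. (\<sigma> ^^ i) (y j))"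
    if "\<And>j. j \<in> J \<Longrightarrow> y j \<in> L" for i J and y :: "nat \<Rightarrow> 'a"
    using that
    by (induction J rule: infinite_finite_induct)
      (auto simp: pow_0 pow_add subfield_Omega_sum[OF L])
  have \<theta>_pow: "(\<theta> ^^ i) c = (\<sigma> ^^ i) c" if "c \<in> F" for i c
    using funpow_eq_on(1)[of F \<theta> \<sigma> c i] \<theta> that by blast
  have fF: "Polynomial.coeff f j \<in> F" for j
    using assms(8) by (simp add: polys_over_def)
  have fL: "Polynomial.coeff f j \<in> L" for j
    using fF \<open>F \<subseteq> L\<close> by blast
  have "semilinear_eval \<sigma> (skew_mult \<theta> g f) x
      = (\<Sum>i\<le>Polynomial.degree g. \<Sum>j\<le>Polynomial.degree f.
           Polynomial.coeff g i * ((\<sigma> ^^ i) (Polynomial.coeff f j) * (\<sigma> ^^ i) ((\<sigma> ^^ j) x)))"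
    using \<theta>_pow[OF fF]
    by (simp add: skew_mult_def semilinear_eval_sum funpow_add mult.assoc)
  also have "\<dots> = (\<Sum>i\<le>Polynomial.degree g. Polynomial.coeff g i *
        (\<sigma> ^^ i) (\<Sum>j\<le>Polynomial.degree f. Polynomial.coeff f j * (\<sigma> ^^ j) x))"
    unfolding sum_distrib_left[symmetric]
    using assms(9) fL
    by (simp add: pow_sum pow_mult pow_closed subfield_Omega_closed(5)[OF L])
  finally show ?thesis by (simp add: semilinear_eval_def)
qed


section \<open>The product bound\<close>

text \<open>Dedekind's independence of characters. Replacing \<open>x\<close> by
  \<open>y * x\<close> in a relation and subtracting \<open>f i y\<close> times the relation removes
  term \<open>i\<close>; choosing \<open>y\<close> with \<open>f j y \<noteq> f i y\<close> then
  gives \<open>v j = 0\<close> by induction.\<close>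

lemma independent_characters:
  fixes f :: "'i \<Rightarrow> 'a \<Rightarrow> 'a::field"
  assumes "finite J" and one: "1 \<in> L" and mult: "\<And>x y. x \<in> L \<Longrightarrow> y \<in> L \<Longrightarrow> x * y \<in> L"
    and f_one: "\<And>i. i \<in> J \<Longrightarrow> f i 1 = 1"
    and f_mult: "\<And>i x y. i \<in> J \<Longrightarrow> x \<in> L \<Longrightarrow> y \<in> L \<Longrightarrow> f i (x * y) = f i x * f i y"
    and distinct: "\<And>i j. i \<in> J \<Longrightarrow> j \<in> J \<Longrightarrow> i \<noteq> j \<Longrightarrow> \<exists>y\<in>L. f i y \<noteq> f j y"
    and zero: "\<And>x. x \<in> L \<Longrightarrow> (\<Sum>j\<in>J. v j * f j x) = 0"
  shows "\<forall>j\<in>J. v j = 0"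
  using assms(1) f_one f_mult distinct zero
proof (induction J arbitrary: v rule: finite_induct)
  case empty
  then show ?case by simp
next
  case (insert i J)
  have vJ: "v j = 0" if j: "j \<in> J" for j
  proof -
    obtain y where y: "y \<in> L" "f j y \<noteq> f i y"
      using insert.prems(3)[of j i] insert.hyps j by auto
    have "\<forall>j\<in>J. v j * (f j y - f i y) = 0"
    proof (rule insert.IH)
      fix x assume x: "x \<in> L"
      have "(\<Sum>j\<in>J. v j * (f j y - f i y) * f j x)
          = (\<Sum>j\<in>insert i J. v j * (f j y - f i y) * f j x)"
        using insert.hyps by simp
      also have "\<dots> = (\<Sum>j\<in>insert i J. v j * f j (y * x)) - f i y * (\<Sum>j\<in>insert i J. v j * f j x)"
        unfolding sum_distrib_left sum_subtractf[symmetric]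
        by (rule sum.cong) (use x y insert.prems(2) in \<open>auto simp: algebra_simps\<close>)
      also have "\<dots> = 0"
        using insert.prems(4) x y mult by auto
      finally show "(\<Sum>j\<in>J. v j * (f j y - f i y) * f j x) = 0" .
    qed (use insert.prems in auto)
    with j y show ?thesis by auto
  qed
  have "v i * f i 1 = 0"
    using insert.prems(4)[OF one] insert.hyps vJ by simp
  then have "v i = 0" using insert.prems(1) by simp
  with vJ show ?case by simp
qed

section \<open>Powers of \<sigma> and the normal basis\<close>

locale cyclic_normal_basis =
  fixes K L :: "'a::field set" and \<sigma> :: "'a \<Rightarrow> 'a" and m :: nat and \<beta> :: 'a
  assumes subfield_K: "subfield K \<Omega>" and subfield_L: "subfield L \<Omega>" and K_L: "K \<subseteq> L"
    and \<sigma>_gal: "\<sigma> \<in> carrier (gal_group L K)"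
    and \<sigma>_order: "\<And>x. x \<in> L \<Longrightarrow> (\<sigma> ^^ m) x = x"
    and m_pos: "m > 0"
    and normal: "normal_element L K \<sigma> m \<beta>"
begin

sublocale gal: group "gal_group L K"
  by (rule group_gal_group[OF subfield_L K_L])

definition s :: "int \<Rightarrow> 'a \<Rightarrow> 'a" where
  "s k = \<sigma> [^]\<^bsub>gal_group L K\<^esub> k"

lemma s_gal: "s k \<in> carrier (gal_group L K)"
  unfolding s_def by (rule gal.int_pow_closed[OF \<sigma>_gal])

lemma s_aut: "s k \<in> carrier (field_aut_group L)" and s_K: "x \<in> K \<Longrightarrow> s k x = x"
  using s_gal[of k] by (auto simp: gal_group_def)

lemmas s_hom = field_aut_groupD(2-5)[OF s_aut]
lemmas L_closed = subfield_Omega_closed[OF subfield_L]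

lemma s_nat: "x \<in> L \<Longrightarrow> s (int j) x = (\<sigma> ^^ j) x"
  unfolding s_def using gal_group_nat_pow[OF subfield_L K_L \<sigma>_gal] by (simp add: int_pow_int)

lemma s_add: "x \<in> L \<Longrightarrow> s (j + k) x = s j (s k x)"
  unfolding s_def by (rule gal_group_int_pow_add[OF subfield_L K_L \<sigma>_gal])

lemma s_zero: "x \<in> L \<Longrightarrow> s 0 x = x"
  using s_nat[of x 0] by simp

lemma s_apply_0: "s k 0 = 0"
  using s_hom(3)[of 0 0 k] L_closed(1) by (metis add.right_neutral add_cancel_right_right)

lemma s_eq_0: "x \<in> L \<Longrightarrow> s k x = 0 \<Longrightarrow> x = 0"
  using s_add[of x "-k" k] s_zero s_apply_0 by simp

lemma s_periodic: "x \<in> L \<Longrightarrow> s (k + q * int m) x = s k x"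
proof -
  have m: "s (int m) y = y" if "y \<in> L" for y
    using that s_nat \<sigma>_order by simp
  have m': "s (- int m) y = y" if "y \<in> L" for y
    using s_add[OF that, of "- int m" "int m"] m s_zero that by simp
  have "s (q * int m) x = x" if "x \<in> L" for x
  proof (induction q rule: int_induct[where k = 0])
    case base
    then show ?case using s_zero that by simp
  next
    case (step1 q)
    then show ?case using s_add[OF that, of "q * int m" "int m"] m that by (simp add: algebra_simps)
  next
    case (step2 q)
    then show ?case
      using s_add[OF that, of "q * int m" "- int m"] m' that by (simp add: algebra_simps)
  qed
  then show "x \<in> L \<Longrightarrow> s (k + q * int m) x = s k x" using s_add by simp
qed

lemma \<beta>_closed: "\<beta> \<in> L"
  using normal by (simp add: normal_element_def)

lemma s_sum:
  "(\<And>i. i \<in> I \<Longrightarrow> f i \<in> L) \<Longrightarrow> s k (\<Sum>i\<in>I. f i) = (\<Sum>i\<in>I. s k (f i))"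
  by (induction I rule: infinite_finite_induct)
    (auto simp: s_hom s_apply_0 subfield_Omega_sum[OF subfield_L])

text \<open>The operator with coefficients \<open>v\<close> is linear over \<open>K\<close>. If it
  kills all conjugates of \<beta>, it kills their span \<open>L\<close>, and independence of
  characters forces \<open>v\<close> to vanish.\<close>

lemma normal_element_annihilator:
  assumes "\<And>k. (\<Sum>j<m. v j * s (int j) (s k \<beta>)) = 0" and "j < m"
  shows "v j = 0"
proof -
  interpret O: ring "\<Omega> :: 'a ring" by (rule ring_Omega)
  let ?bs = "map (\<lambda>j. (\<sigma> ^^ j) \<beta>) [0..<m]"
  have indep: "O.independent K ?bs" and span: "O.Span K ?bs = L"
    using normal by (auto simp: normal_element_def)
  \<comment> \<open>Distinct conjugates of \<beta> show that the powers of \<sigma> are distinct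
    characters.\<close>
  have dist: "distinct ?bs" by (rule O.independent_distinct[OF subfield_K indep])
  have "\<forall>j\<in>{..<m}. v j = 0"
  proof (rule independent_characters[where f = "\<lambda>j. s (int j)" and L = L])
    fix i j assume ij: "i \<in> {..<m}" "j \<in> {..<m}" "i \<noteq> j"
    then have "?bs ! i \<noteq> ?bs ! j" using dist by (subst nth_eq_iff_index_eq) auto
    then have "s (int i) \<beta> \<noteq> s (int j) \<beta>" using ij s_nat[OF \<beta>_closed] by simp
    then show "\<exists>y\<in>L. s (int i) y \<noteq> s (int j) y" using \<beta>_closed by blast
  next
    fix x assume "x \<in> L"
    then have "x \<in> O.Span K ?bs" by (simp only: span)
    then obtain c where c: "\<And>i. c i \<in> K" "x = (\<Sum>i<length ?bs. c i * ?bs ! i)"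
      using Span_OmegaE[OF subfield_K] by blast
    have x: "x = (\<Sum>i<m. c i * s (int i) \<beta>)"
      unfolding c(2) by (rule sum.cong) (auto simp: s_nat[OF \<beta>_closed])
    have cL: "c i \<in> L" for i using c(1) K_L by blast
    have "s (int j) x = (\<Sum>i<m. c i * s (int j) (s (int i) \<beta>))" for j
    proof -
      have "s (int j) x = (\<Sum>i<m. s (int j) (c i * s (int i) \<beta>))"
        unfolding x by (rule s_sum) (intro L_closed(5) cL s_hom(1) \<beta>_closed)
      then show ?thesis
        using s_hom(4)[OF cL s_hom(1)[OF \<beta>_closed]] s_K[OF c(1)] by simp
    qed
    then have "(\<Sum>j<m. v j * s (int j) x)
        = (\<Sum>j<m. v j * (\<Sum>i<m. c i * s (int j) (s (int i) \<beta>)))" by simp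
    also have "\<dots> = (\<Sum>i<m. c i * (\<Sum>j<m. v j * s (int j) (s (int i) \<beta>)))"
      unfolding sum_distrib_left by (subst sum.swap) (simp add: ac_simps)
    also have "\<dots> = 0" using assms(1) by simp
    finally show "(\<Sum>j<m. v j * s (int j) x) = 0" .
  qed (use L_closed s_hom in auto)
  then show ?thesis using assms(2) by simp
qed

text \<open>The first factor contributes one term per nonzero coefficient \<open>c u\<close>, the
  second one term per \<open>A p\<close>. The product is thus a combination to which the grid lemma
  applies, with the number of terms bounded by \<open>card\<close>.\<close>

lemma product_vanishes:
  fixes c v :: "nat \<Rightarrow> 'a" and e :: "nat \<Rightarrow> nat \<Rightarrow> 'a"
  assumes a: "a \<in> K" "a ^ l = 1" and "l > 0"
    and cL: "\<And>u. u < l \<Longrightarrow> c u \<in> L"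
    and A: "\<And>p. p < w \<Longrightarrow> A p \<in> L" and e: "\<And>p j. e p j \<in> K"
    and v: "\<And>j. j < m \<Longrightarrow> v j = (\<Sum>p<w. e p j * A p)"
    and cop: "coprime t1 (int (l * m))" and g: "gcd (int (l * m)) t2 \<le> int d"
    and card: "card {u. u < l \<and> c u \<noteq> 0} * w \<le> d + r"
    and zero: "\<And>i j k. i < d \<Longrightarrow> j \<le> r \<Longrightarrow> k = int i * t1 + int j * t2 \<Longrightarrow>
       (\<Sum>u<l. c u * (a powi (b + k)) ^ u) * (\<Sum>j<m. v j * s (int j) (s k \<beta>)) = 0"
  shows "(\<Sum>u<l. c u * (a powi (b + k)) ^ u) * (\<Sum>j<m. v j * s (int j) (s k \<beta>)) = 0"
proof -
  define U where "U = {u. u < l \<and> c u \<noteq> 0}"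
  \<comment> \<open>The \<open>e p j\<close> lie in \<open>K\<close> and are fixed by
    \<open>s k\<close>, so the second factor becomes the sum of the
    \<open>A p * s k (\<gamma> p)\<close>.\<close>
  define \<gamma> where "\<gamma> p = (\<Sum>j<m. e p j * s (int j) \<beta>)" for p
  define \<phi> where "\<phi> = (\<lambda>(u, p) k. a powi (int u * k) * s k (\<gamma> p))"
  \<comment> \<open>\<open>s t\<close> fixes the power of \<open>a\<close> and moves only the index
    of \<open>s\<close>; this factor compensates for the exponent \<open>k + t\<close> of
    \<open>a\<close> in the shifted sequence.\<close>
  define \<epsilon> :: "nat \<times> nat \<Rightarrow> int \<Rightarrow> 'a" where "\<epsilon> = (\<lambda>(u, p) t. a powi (- int u * t))"
  define q where "q = (\<lambda>(u, p). c u * a powi (int u * b) * A p)"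
  have a0: "a \<noteq> 0" using a(2) \<open>l > 0\<close> by (cases l) auto
  have aK: "a powi k \<in> K" for k by (rule subfield_Omega_powi[OF subfield_K a(1)])
  then have aL: "a powi k \<in> L" for k using K_L by blast
  have a_l: "a powi (int l * k) = 1" for k
    using a(2) by (simp add: power_int_mult)
  have eL: "e p j \<in> L" for p j using e K_L by blast
  have \<gamma>L: "\<gamma> p \<in> L" for p
    unfolding \<gamma>_def
    by (intro subfield_Omega_sum[OF subfield_L] L_closed(5) eL s_hom(1) \<beta>_closed)
  interpret seq: semilinear_sequences L s \<phi> \<epsilon> "int (l * m)"
  proof
    show "\<phi> i k \<in> L" for i k
      by (cases i) (simp add: \<phi>_def L_closed(5) aL s_hom(1) \<gamma>L)
    show "\<epsilon> i t \<in> L" for i t by (cases i) (simp only: \<epsilon>_def case_prod_conv aL)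
    show "\<epsilon> i t \<noteq> 0" for i t using a0 by (cases i) (auto simp: \<epsilon>_def)
    show "s t (\<phi> i k) = \<epsilon> i t * \<phi> i (k + t)" for i k t
    proof (cases i)
      case (Pair u p)
      have "a powi (int u * k) = a powi (- int u * t) * a powi (int u * (k + t))"
        using a0 by (simp add: power_int_add[symmetric] algebra_simps)
      moreover have "s t (a powi (int u * k) * s k (\<gamma> p)) = a powi (int u * k) * s (k + t) (\<gamma> p)"
        using s_add[OF \<gamma>L, of t k p] s_hom(4)[OF aL s_hom(1)[OF \<gamma>L]] s_K[OF aK]
        by (simp add: add.commute)
      ultimately show ?thesis by (simp add: Pair \<phi>_def \<epsilon>_def)
    qed
    \<comment> \<open>The power of \<open>a\<close> repeats after \<open>l\<close> steps and
      \<open>s\<close> after \<open>m\<close>.\<close>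
    show "\<phi> i (k + int (l * m)) = \<phi> i k" for i k
    proof (cases i)
      case (Pair u p)
      have "a powi (int u * (k + int (l * m))) = a powi (int u * k + int l * (int u * int m))"
        by (simp add: algebra_simps)
      also have "\<dots> = a powi (int u * k)" using a0 a_l by (simp add: power_int_add)
      finally show ?thesis
        using s_periodic[OF \<gamma>L, of k "int l"] by (simp add: Pair \<phi>_def)
    qed
    show "s t (x + y) = s t x + s t y" if "x \<in> L" "y \<in> L" for x y t using s_hom that by blast
    show "x = 0" if "x \<in> L" "s t x = 0" for x t using s_eq_0 that by blast
  qed (simp_all add: L_closed s_hom \<open>l > 0\<close> m_pos)
  let ?I = "U \<times> {..<w}"
  have V: "(\<Sum>j<m. v j * s (int j) (s k \<beta>)) = (\<Sum>p<w. A p * s k (\<gamma> p))" for k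
  proof -
    have "(\<Sum>p<w. A p * s k (\<gamma> p)) = (\<Sum>p<w. A p * (\<Sum>j<m. e p j * s (int j) (s k \<beta>)))"
    proof (rule sum.cong)
      fix p
      have "s k (\<gamma> p) = (\<Sum>j<m. e p j * s k (s (int j) \<beta>))"
        unfolding \<gamma>_def
        using s_sum[of "{..<m}" "\<lambda>j. e p j * s (int j) \<beta>" k]
          s_hom(4)[OF eL s_hom(1)[OF \<beta>_closed]] s_K[OF e] L_closed(5)[OF eL s_hom(1)[OF \<beta>_closed]]
        by simp
      also have "\<dots> = (\<Sum>j<m. e p j * s (int j) (s k \<beta>))"
        by (simp add: s_add[OF \<beta>_closed, symmetric] add.commute)
      finally show "A p * s k (\<gamma> p) = A p * (\<Sum>j<m. e p j * s (int j) (s k \<beta>))" by simp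
    qed simp
    also have "\<dots> = (\<Sum>j<m. (\<Sum>p<w. e p j * A p) * s (int j) (s k \<beta>))"
      unfolding sum_distrib_left sum_distrib_right by (subst sum.swap) (simp add: ac_simps)
    also have "\<dots> = (\<Sum>j<m. v j * s (int j) (s k \<beta>))" using v by simp
    finally show ?thesis by simp
  qed
  \<comment> \<open>Zero coefficients are dropped, so that the Hamming weight rather than
    \<open>l\<close> counts the terms.\<close>
  have W: "(\<Sum>u<l. c u * (a powi (b + k)) ^ u) = (\<Sum>u\<in>U. c u * a powi (int u * b) * a powi (int u * k))" for k
  proof -
    have "(\<Sum>u<l. c u * (a powi (b + k)) ^ u) = (\<Sum>u\<in>U. c u * (a powi (b + k)) ^ u)"
      by (rule sum.mono_neutral_right) (auto simp: U_def)
    also have "\<dots> = (\<Sum>u\<in>U. c u * (a powi (int u * b) * a powi (int u * k)))"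
    proof (rule sum.cong)
      fix u
      have "(a powi (b + k)) ^ u = a powi ((b + k) * int u)"
        by (simp add: power_int_mult)
      also have "\<dots> = a powi (int u * b + int u * k)" by (simp add: algebra_simps)
      finally show "c u * (a powi (b + k)) ^ u = c u * (a powi (int u * b) * a powi (int u * k))"
        using a0 by (simp add: power_int_add)
    qed simp
    finally show ?thesis by (simp add: mult.assoc)
  qed
  have comb: "(\<Sum>u<l. c u * (a powi (b + k)) ^ u) * (\<Sum>j<m. v j * s (int j) (s k \<beta>)) = seq.comb ?I q k" for k
    unfolding V W seq.comb_def sum_product sum.cartesian_product
    by (rule sum.cong) (auto simp: q_def \<phi>_def)
  have q: "q \<in> ?I \<rightarrow> L"
    by (auto simp: q_def U_def L_closed(5) cL aL A)
  have "seq.comb ?I q k = 0"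
  proof (rule seq.comb_zero_Hartmann_Tzeng[OF _ q cop g, of r 0])
    show "card ?I \<le> d + r" using card by (simp add: card_cartesian_product U_def)
    show "seq.comb ?I q (0 + int i * t1 + int j * t2) = 0" if "i < d" "j \<le> r" for i j
      using zero[OF that refl] comb by simp
  qed (simp add: U_def)
  then show ?thesis using comb by simp
qed

text \<open>A nonzero polynomial of degree below \<open>l\<close> cannot vanish at all
  \<open>l\<close> powers of \<open>a\<close>, and the second factor is somewhere nonzero by
  \<open>normal_element_annihilator\<close>. The factors have the coprime periods \<open>l\<close>
  and \<open>m\<close>, so one \<open>k\<close> serves both.\<close>

lemma product_nonzero:
  fixes c v :: "nat \<Rightarrow> 'a"
  assumes a: "primitive_root_of_unity l a" and "l > 0" and cop: "coprime l m"
    and c: "u < l" "c u \<noteq> 0" and v: "j < m" "v j \<noteq> 0"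
  shows "\<exists>k. (\<Sum>u<l. c u * (a powi (b + k)) ^ u) * (\<Sum>j<m. v j * s (int j) (s k \<beta>)) \<noteq> 0"
proof -
  have al: "a ^ l = 1" using a by (simp add: primitive_root_of_unity_def)
  have a0: "a \<noteq> 0" using al \<open>l > 0\<close> by (cases l) auto
  obtain k2 where k2: "(\<Sum>j<m. v j * s (int j) (s k2 \<beta>)) \<noteq> 0"
    using normal_element_annihilator v by blast
  define P where "P = (\<Sum>u<l. Polynomial.monom (c u) u)"
  have P_coeff: "Polynomial.coeff P u = c u" if "u < l" for u
    using that by (simp add: P_def Polynomial.coeff_sum)
  have P0: "P \<noteq> 0" using P_coeff c by fastforce
  have P_deg: "Polynomial.degree P < l"
    unfolding P_def using \<open>l > 0\<close>
    by (intro Polynomial.degree_sum_less) (auto intro: le_less_trans[OF Polynomial.degree_monom_le])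
  have inj: "inj_on (\<lambda>i. a ^ i) {..<l}"
  proof (rule linorder_inj_onI)
    fix i j assume ij: "i < j" "i \<in> {..<l}" "j \<in> {..<l}"
    then have "a ^ j = a ^ i * a ^ (j - i)" by (simp add: power_add[symmetric])
    moreover have "a ^ (j - i) \<noteq> 1"
      using a ij by (auto simp: primitive_root_of_unity_def)
    ultimately show "a ^ i \<noteq> a ^ j" using a0 by simp
  qed auto
  have "\<exists>i<l. poly P (a ^ i) \<noteq> 0"
  proof (rule ccontr)
    assume "\<not> (\<exists>i<l. poly P (a ^ i) \<noteq> 0)"
    then have "(\<lambda>i. a ^ i) ` {..<l} \<subseteq> {x. poly P x = 0}" by auto
    then have "card ((\<lambda>i. a ^ i) ` {..<l}) \<le> card {x. poly P x = 0}"
      by (rule card_mono[OF poly_roots_finite[OF P0]])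
    also have "\<dots> \<le> Polynomial.degree P" by (rule card_poly_roots_bound[OF P0])
    finally show False using P_deg inj by (simp add: card_image)
  qed
  then obtain i where i: "poly P (a ^ i) \<noteq> 0" by blast
  \<comment> \<open>The first factor is read at exponent \<open>b + k\<close>, whence the
    offset.\<close>
  define k1 where "k1 = int i - b"
  obtain x y where xy: "x * int l + y * int m = 1"
    using cop bezout_int[of "int l" "int m"] by (auto simp: coprime_iff_gcd_eq_1)
  \<comment> \<open>The Chinese remainder solution, congruent to \<open>k1\<close> modulo
    \<open>l\<close> and to \<open>k2\<close> modulo \<open>m\<close>.\<close>
  define k where "k = k1 * (y * int m) + k2 * (x * int l)"
  have "k = k1 * (x * int l + y * int m) + int l * ((k2 - k1) * x)"
    "k = k2 * (x * int l + y * int m) + ((k1 - k2) * y) * int m"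
    by (simp_all add: k_def algebra_simps)
  then have k: "k = k1 + int l * ((k2 - k1) * x)" "k = k2 + ((k1 - k2) * y) * int m"
    by (simp_all only: xy mult_1_right)
  have "a powi (b + k) = a powi int i * a powi (int l * ((k2 - k1) * x))"
    using a0 by (subst power_int_add[symmetric]) (auto simp: k(1) k1_def algebra_simps)
  then have "a powi (b + k) = a ^ i" using al by (simp add: power_int_mult)
  then have "(\<Sum>u<l. c u * (a powi (b + k)) ^ u) = poly P (a ^ i)"
    by (simp add: P_def poly_sum poly_monom)
  moreover have "s k \<beta> = s k2 \<beta>" unfolding k(2) by (rule s_periodic[OF \<beta>_closed])
  ultimately show ?thesis using i k2 by (intro exI[of _ k]) simp
qed

end

section \<open>From the hypotheses on fields and codes to the sequences\<close>

text \<open>The fixed points of an automorphism are closed under all field operations. This will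
  reduce the triviality of the \<open>m\<close>-th power of \<sigma> on \<open>L\<close> to
  \<open>F\<close> and \<open>K\<close>.\<close>

lemma field_aut_fixes_generate_field:
  fixes H :: "'a::field set"
  assumes L: "L = generate_field \<Omega> H" and \<tau>: "\<tau> \<in> carrier (field_aut_group L)"
    and H: "\<And>x. x \<in> H \<Longrightarrow> \<tau> x = x" and x: "x \<in> L"
  shows "\<tau> x = x"
proof -
  interpret field "\<Omega> :: 'a ring" by (rule field_Omega)
  have sub: "subfield L \<Omega>" unfolding L by (rule generate_field_is_subfield) simp
  note L_closed = subfield_Omega_closed[OF sub] and hom = field_aut_groupD(2-5)[OF \<tau>]
  have \<tau>0: "\<tau> 0 = 0"
    using hom(3)[of 0 0] L_closed(1) by (metis add.right_neutral add_cancel_right_right)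
  have "x \<in> generate_field \<Omega> H" using x L by simp
  then have "x \<in> L \<and> \<tau> x = x"
  proof (induction rule: generate_field.induct)
    case one
    then show ?case using L_closed hom by simp
  next
    case (incl h)
    then show ?case using H by (simp add: L generate_field.incl)
  next
    case (a_inv h)
    then have h: "h \<in> L" "\<tau> h = h" by auto
    have "- h \<in> L" using L_closed(4)[OF L_closed(1) h(1)] by simp
    moreover have "\<tau> (- h) = - h"
      using hom(3)[OF h(1) \<open>- h \<in> L\<close>] h(2) \<tau>0 by (simp add: add_eq_0_iff)
    ultimately show ?case by simp
  next
    case (m_inv h)
    then have h: "h \<in> L" "\<tau> h = h" "h \<noteq> 0" by auto
    have "h * \<tau> (inverse h) = 1"
      using hom(4)[OF h(1) L_closed(6)[OF h(1)]] h hom(2) by simp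
    then have "\<tau> (inverse h) = inverse h" by (rule inverse_unique[symmetric])
    then show ?case using L_closed(6)[OF h(1)] by (simp add: m_inv_Omega[OF h(3)])
  next
    case (eng_add h1 h2)
    then show ?case using L_closed hom by simp
  next
    case (eng_mult h1 h2)
    then show ?case using L_closed hom by simp
  qed
  then show ?thesis by simp
qed

lemma field_aut_group_funpow_ord:
  assumes "subfield F \<Omega>" "\<theta> \<in> carrier (field_aut_group F)" "x \<in> F"
  shows "(\<theta> ^^ group.ord (field_aut_group F) \<theta>) x = x"
proof -
  have F: "field_aut_group F = gal_group F {}" by (rule field_aut_group_eq)
  interpret group "field_aut_group F"
    unfolding F by (rule group_gal_group[OF assms(1)]) simp
  have "\<one>\<^bsub>field_aut_group F\<^esub> = (\<lambda>x\<in>F. x)"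
    by (simp add: field_aut_group_def BijGroup_def)
  then have "(\<theta> [^]\<^bsub>field_aut_group F\<^esub> ord \<theta>) x = x"
    using pow_ord_eq_1[OF assms(2)] assms(3) by simp
  then show ?thesis
    using gal_group_nat_pow[OF assms(1) _ _ assms(3), of "{}" \<theta> "ord \<theta>"] assms(2) F by simp
qed

lemma min_distance_attained:
  assumes "linear_code F n C" "C \<noteq> {0\<^sub>v n}"
  obtains v where "v \<in> C" "v \<noteq> 0\<^sub>v n" "min_distance wt n C = wt v"
proof -
  \<comment> \<open>The code contains 0 but is not \<open>{0}\<close>; an infimum of a nonempty set
    of naturals is attained.\<close>
  have "wt ` (C - {0\<^sub>v n}) \<noteq> {}" using assms by (auto simp: linear_code_def)
  then have "min_distance wt n C \<in> wt ` (C - {0\<^sub>v n})"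
    unfolding min_distance_def by (rule Inf_nat_def1)
  then show thesis using that by auto
qed

lemma vec_nonzero_entry:
  fixes v :: "'a::zero vec"
  assumes "v \<in> carrier_vec n" "v \<noteq> 0\<^sub>v n"
  obtains i where "i < n" "v $ i \<noteq> 0"
  using assms by (metis carrier_vecD eq_vecI index_zero_vec)

text \<open>\<open>y\<close> is a root of both generators of the ideal, \<open>f\<close> and the
  polynomial x^l - 1.\<close>

lemma cyclic_code_root:
  assumes "cyclic_generator F l C f" "c \<in> C" "poly f y = 0" "y ^ l = 1"
  shows "(\<Sum>u<dim_vec c. c $ u * y ^ u) = 0"
proof -
  have "code_poly c \<in> code_poly ` C" using assms(2) by simp
  then obtain g h where "code_poly c = g * f + h * (Polynomial.monom 1 l - 1)"
    using assms(1) unfolding cyclic_generator_def by blast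
  then have "poly (code_poly c) y = 0" using assms(3,4) by (simp add: poly_monom)
  then show ?thesis by (simp add: poly_code_poly)
qed

text \<open>Skew products act by composition with the right factor first. Both \<open>f\<close> and
  z^m - 1 send \<open>x\<close> to 0, hence so does every element of the left ideal they
  generate.\<close>

lemma (in cyclic_normal_basis) skew_cyclic_code_root:
  assumes "F \<subseteq> L" and F: "subfield F \<Omega>"
    and \<theta>: "\<And>x. x \<in> F \<Longrightarrow> \<theta> x = \<sigma> x" "\<And>x. x \<in> F \<Longrightarrow> \<theta> x \<in> F"
    and gen: "skew_cyclic_generator F \<theta> m C f" and "v \<in> C"
    and x: "x \<in> L" "x \<noteq> 0" and zero: "skew_eval \<sigma> x f = 0"
  shows "(\<Sum>j<dim_vec v. v $ j * (\<sigma> ^^ j) x) = 0"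
proof -
  have "\<sigma> \<in> carrier (field_aut_group L)" using \<sigma>_gal by (simp add: gal_group_def)
  note \<sigma>_hom = field_aut_groupD(2-5)[OF this]
  have eval: "semilinear_eval \<sigma> (skew_mult \<theta> g p) x = semilinear_eval \<sigma> g (semilinear_eval \<sigma> p x)"
    if "p \<in> polys_over F" for g p
    by (rule semilinear_eval_skew_mult[OF subfield_L assms(1)])
      (use \<sigma>_hom \<theta> that x(1) in \<open>blast+\<close>)
  have "skew_eval \<sigma> x f = semilinear_eval \<sigma> f x * inverse x"
    by (simp add: skew_eval_def semilinear_eval_def sum_distrib_right)
  then have f: "semilinear_eval \<sigma> f x = 0" using zero x(2) by simp
  let ?z = "Polynomial.monom 1 m - 1 :: 'a poly"
  have z: "?z = Polynomial.monom 1 m + Polynomial.monom (- 1) 0"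
    by (simp add: monom_0 one_pCons)
  have ev_z: "semilinear_eval \<sigma> ?z x = 0"
    unfolding z semilinear_eval_add using \<sigma>_order[OF x(1)] by simp
  have z_F: "?z \<in> polys_over F"
    using subfield_Omega_closed(1,2)[OF F] subfield_Omega_closed(4)[OF F]
    by (auto simp: polys_over_def Polynomial.coeff_diff Polynomial.coeff_1)
  have f_F: "f \<in> polys_over F" using gen by (simp add: skew_cyclic_generator_def)
  \<comment> \<open>The outer operators \<open>g\<close> and \<open>h\<close> are then applied to 0
    and must return 0.\<close>
  have \<sigma>0: "(\<sigma> ^^ j) 0 = 0" for j
    using s_nat[OF L_closed(1), of j] s_apply_0 by simp
  have "code_poly v \<in> code_poly ` C" using assms(6) by simp
  then obtain g h where "code_poly v = skew_mult \<theta> g f + skew_mult \<theta> h ?z"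
    using gen unfolding skew_cyclic_generator_def by blast
  then have "semilinear_eval \<sigma> (code_poly v) x
      = semilinear_eval \<sigma> g 0 + semilinear_eval \<sigma> h 0"
    by (simp only: semilinear_eval_add eval[OF f_F] eval[OF z_F] f ev_z)
  then have "semilinear_eval \<sigma> (code_poly v) x = 0"
    by (simp add: semilinear_eval_def[of _ _ 0] \<sigma>0)
  then show ?thesis by (simp add: semilinear_eval_code_poly)
qed

text \<open>For \<open>q = 0\<close> the quotient is 0 by convention, so neither distance has to be
  shown positive.\<close>

lemma ceiling_divide_le_of_le_mult:
  assumes "x \<le> int (p * q)"
  shows "\<lceil>real_of_int x / real q\<rceil> \<le> int p"
proof (cases "q = 0")
  case False
  have "real_of_int x \<le> real p * real q"
    using assms by (metis of_int_le_iff of_int_of_nat_eq of_nat_mult)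
  then have "real_of_int x / real q \<le> real p"
    using False by (simp add: divide_le_eq)
  then show ?thesis by (simp add: ceiling_le_iff)
qed simp

theorem theorem6p3:
  fixes E F K L :: "'a::field set"
    and \<sigma> \<theta> :: "'a \<Rightarrow> 'a"
    and h m l d\<^sub>H d\<^sub>r\<^sub>k :: nat
    and C\<^sub>1 C\<^sub>2 :: "'a vec set"
    and f\<^sub>1 f\<^sub>2 :: "'a poly"
    and b \<delta> r t\<^sub>1 t\<^sub>2 :: int
    and a \<beta> :: 'a
  assumes "subfield E \<Omega>" and "subfield F \<Omega>" and "subfield K \<Omega>"
    and "K \<inter> F = E"
    and "ring.dimension \<Omega> h E K" and "ring.dimension \<Omega> m E F"
    and "L = generate_field \<Omega> (F \<union> K)"
    and "ring.dimension \<Omega> h F L" and "ring.dimension \<Omega> m K L"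
    and "cyclic_galois_extension L K"
    and "\<sigma> \<in> carrier (gal_group L K)"
    and "\<theta> = restrict \<sigma> F"
    and "\<theta> \<in> carrier (field_aut_group F)"
    and "group.ord (field_aut_group F) \<theta> = m"
    and "{x \<in> F. \<theta> x = x} = E"
    and "l > 0"
    and "card (roots_of_unity_in K l) = l"
    and "CHAR('a) = 0 \<or> coprime l CHAR('a)"
    and "coprime l m"
    and "cyclic_code F l C\<^sub>1" and "C\<^sub>1 \<noteq> {0\<^sub>v l}"
    and "cyclic_generator F l C\<^sub>1 f\<^sub>1" and "f\<^sub>1 \<in> polys_over E"
    and "d\<^sub>H = min_distance hamming_weight l C\<^sub>1"
    and "skew_cyclic_code F \<theta> m C\<^sub>2" and "C\<^sub>2 \<noteq> {0\<^sub>v m}"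
    and "skew_cyclic_generator F \<theta> m C\<^sub>2 f\<^sub>2"
    and "d\<^sub>r\<^sub>k = min_distance (rank_weight E) m C\<^sub>2"
    and "r \<ge> 0"
    and "gcd (int (l * m)) t\<^sub>1 = 1" and "gcd (int (l * m)) t\<^sub>2 < \<delta>"
    and "a \<in> K" and "primitive_root_of_unity l a"
    and "normal_element L K \<sigma> m \<beta>"
    and "{(a powi (b + i * t\<^sub>1 + s * t\<^sub>2), (\<sigma> [^]\<^bsub>gal_group L K\<^esub> (i * t\<^sub>1 + s * t\<^sub>2)) \<beta>) | i s.
            0 \<le> i \<and> i \<le> \<delta> - 2 \<and> 0 \<le> s \<and> s \<le> r}
         \<subseteq> uplus_set (roots_of_unity_in K l) (L - {0})
              (hamming_defining_set K l f\<^sub>1) (rank_defining_set L \<sigma> f\<^sub>2)"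
  shows "int d\<^sub>H \<ge> \<lceil>real_of_int (\<delta> + r) / real d\<^sub>r\<^sub>k\<rceil> \<and>
         int d\<^sub>r\<^sub>k \<ge> \<lceil>real_of_int (\<delta> + r) / real d\<^sub>H\<rceil>"
proof -
  interpret O: field "\<Omega> :: 'a ring" by (rule field_Omega)
  have subfield_L: "subfield L \<Omega>"
    unfolding assms(7) by (rule O.generate_field_is_subfield) simp
  have FK: "F \<subseteq> L" "K \<subseteq> L"
    unfolding assms(7) using generate_field.incl[of _ "F \<union> K"] by auto
  have E: "E \<subseteq> F" "E \<subseteq> K" using assms(4) by auto
  have \<theta>: "\<theta> x = \<sigma> x" "\<theta> x \<in> F" if "x \<in> F" for x
    using that assms(12) field_aut_groupD(2)[OF assms(13)] by auto
  have \<theta>_pow: "(\<theta> ^^ i) c = (\<sigma> ^^ i) c" if "c \<in> F" for i c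
    using funpow_eq_on(1)[of F \<theta> \<sigma> c i] \<theta> that by blast
  have \<sigma>_pow: "\<sigma> [^]\<^bsub>gal_group L K\<^esub> m \<in> carrier (gal_group L K)"
    by (rule monoid.nat_pow_closed[OF group.is_monoid[OF group_gal_group[OF subfield_L FK(2)]] assms(11)])
  \<comment> \<open>The \<open>m\<close>-th power of \<sigma> fixes \<open>K\<close> by membership
    in the Galois group and \<open>F\<close> because \<theta> has order \<open>m\<close>; together
    they generate \<open>L\<close>.\<close>
  have \<sigma>_order: "(\<sigma> ^^ m) x = x" if x: "x \<in> L" for x
  proof -
    have "(\<sigma> [^]\<^bsub>gal_group L K\<^esub> m) x = x"
    proof (rule field_aut_fixes_generate_field[OF assms(7) _ _ x])
      show "\<sigma> [^]\<^bsub>gal_group L K\<^esub> m \<in> carrier (field_aut_group L)"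
        using \<sigma>_pow by (simp add: gal_group_def)
      fix y assume "y \<in> F \<union> K"
      then show "(\<sigma> [^]\<^bsub>gal_group L K\<^esub> m) y = y"
      proof
        assume y: "y \<in> F"
        then have "(\<sigma> ^^ m) y = y"
          using field_aut_group_funpow_ord[OF assms(2,13)] \<theta>_pow assms(14) by simp
        then show ?thesis
          using gal_group_nat_pow[OF subfield_L FK(2) assms(11)] y FK(1) by auto
      next
        assume "y \<in> K"
        then show ?thesis using \<sigma>_pow unfolding gal_group_def by auto
      qed
    qed
    then show ?thesis using gal_group_nat_pow[OF subfield_L FK(2) assms(11) x] by simp
  qed
  have code1: "linear_code F l C\<^sub>1" and code2: "linear_code F m C\<^sub>2"
    using assms(20,25) by (auto simp: cyclic_code_def skew_cyclic_code_def)
  obtain c where c: "c \<in> C\<^sub>1" "c \<noteq> 0\<^sub>v l" "d\<^sub>H = hamming_weight c"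
    using min_distance_attained[OF code1 assms(21)] assms(24) by metis
  obtain v where v: "v \<in> C\<^sub>2" "v \<noteq> 0\<^sub>v m" "d\<^sub>r\<^sub>k = rank_weight E v"
    using min_distance_attained[OF code2 assms(26)] assms(28) by metis
  have c_vec: "c \<in> carrier_vec l" "\<And>u. u < l \<Longrightarrow> c $ u \<in> F"
    and v_vec: "v \<in> carrier_vec m" "\<And>j. j < m \<Longrightarrow> v $ j \<in> F"
    using c(1) v(1) code1 code2 by (auto simp: linear_code_def)
  obtain u0 where u0: "u0 < l" "c $ u0 \<noteq> 0" using vec_nonzero_entry[OF c_vec(1) c(2)] .
  obtain j0 where j0: "j0 < m" "v $ j0 \<noteq> 0" using vec_nonzero_entry[OF v_vec(1) v(2)] .
  \<comment> \<open>\<open>m > 0\<close> comes from the index \<open>j0 < m\<close> of a nonzero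
    entry.\<close>
  interpret cyclic_normal_basis K L \<sigma> m \<beta>
    by (rule cyclic_normal_basis.intro)
      (use assms(3,11,34) subfield_L FK(2) \<sigma>_order j0(1) in simp_all)
  obtain A e where A: "\<And>p. p < d\<^sub>r\<^sub>k \<Longrightarrow> A p \<in> F" and e: "\<And>p j. e p j \<in> E"
    and v_eq: "\<And>j. j < m \<Longrightarrow> v $ j = (\<Sum>p<d\<^sub>r\<^sub>k. e p j * A p)"
    using rank_weight_decomposition[OF assms(1,2) E(1), of v] v_vec v(3) by auto
  have al: "a ^ l = 1" using assms(33) by (simp add: primitive_root_of_unity_def)
  \<comment> \<open>This inequality is symmetric in the two distances and yields both
    claims.\<close>
  have bound: "\<delta> + r \<le> int (d\<^sub>H * d\<^sub>r\<^sub>k)"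
  proof (rule ccontr)
    assume "\<not> \<delta> + r \<le> int (d\<^sub>H * d\<^sub>r\<^sub>k)"
    \<comment> \<open>A gcd is nonnegative, so \<open>\<delta> - 1\<close> is a natural number: the
      number of grid points per row. The negated bound then says that there are at most
      \<open>(\<delta> - 1) + r\<close> terms.\<close>
    moreover have "\<delta> \<ge> 1" using assms(31) gcd_ge_0_int[of "int (l * m)" t\<^sub>2] by linarith
    ultimately have weights: "d\<^sub>H * d\<^sub>r\<^sub>k \<le> nat (\<delta> - 1) + nat r" using assms(29) by linarith
    have vanish: "(\<Sum>u<l. c $ u * (a powi (b + k)) ^ u) * (\<Sum>j<m. v $ j * s (int j) (s k \<beta>)) = 0"
      if ij: "i < nat (\<delta> - 1)" "j \<le> nat r" and k: "k = int i * t\<^sub>1 + int j * t\<^sub>2" for i j k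
    proof -
      have "(a powi (b + int i * t\<^sub>1 + int j * t\<^sub>2), (\<sigma> [^]\<^bsub>gal_group L K\<^esub> (int i * t\<^sub>1 + int j * t\<^sub>2)) \<beta>)
          \<in> uplus_set (roots_of_unity_in K l) (L - {0})
              (hamming_defining_set K l f\<^sub>1) (rank_defining_set L \<sigma> f\<^sub>2)"
        by (rule subsetD[OF assms(35)], rule CollectI, rule exI[of _ "int i"], rule exI[of _ "int j"])
          (use ij assms(29) in auto)
      then have "(a powi (b + k), s k \<beta>) \<in> uplus_set (roots_of_unity_in K l) (L - {0})
              (hamming_defining_set K l f\<^sub>1) (rank_defining_set L \<sigma> f\<^sub>2)"
        by (simp add: k s_def add.assoc)
      \<comment> \<open>Every grid point lies in one of the two defining sets, which annihilates the
        factor of \<open>c\<close> or that of \<open>v\<close>.\<close>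
      then consider "a powi (b + k) \<in> hamming_defining_set K l f\<^sub>1" | "s k \<beta> \<in> rank_defining_set L \<sigma> f\<^sub>2"
        by (auto simp: uplus_set_def)
      then show ?thesis
      proof cases
        case 1
        then have "(\<Sum>u<dim_vec c. c $ u * (a powi (b + k)) ^ u) = 0"
          by (intro cyclic_code_root[OF assms(22) c(1)])
            (auto simp: hamming_defining_set_def roots_of_unity_in_def)
        then show ?thesis using c_vec(1) by simp
      next
        case 2
        then have "(\<Sum>j<dim_vec v. v $ j * (\<sigma> ^^ j) (s k \<beta>)) = 0"
          by (intro skew_cyclic_code_root[OF FK(1) assms(2) \<theta> assms(27) v(1)])
            (auto simp: rank_defining_set_def)
        then show ?thesis using v_vec(1) s_nat[OF s_hom(1)[OF \<beta>_closed]] by simp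
      qed
    qed
    \<comment> \<open>The zeros spread from the grid to all integers, in conflict with the nonzero
      entries at \<open>u0\<close> and \<open>j0\<close>.\<close>
    have "(\<Sum>u<l. c $ u * (a powi (b + k)) ^ u) * (\<Sum>j<m. v $ j * s (int j) (s k \<beta>)) = 0" for k
    proof (rule product_vanishes[OF assms(32) al assms(16)])
      show "coprime t\<^sub>1 (int (l * m))" using assms(30) by (simp add: coprime_iff_gcd_eq_1 gcd.commute)
      show "gcd (int (l * m)) t\<^sub>2 \<le> int (nat (\<delta> - 1))" using assms(31) \<open>\<delta> \<ge> 1\<close> by simp
      show "card {u. u < l \<and> c $ u \<noteq> 0} * d\<^sub>r\<^sub>k \<le> nat (\<delta> - 1) + nat r"
        using weights c(3) c_vec(1) by (simp add: hamming_weight_def)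
      show "c $ u \<in> L" if "u < l" for u using c_vec(2)[OF that] FK by blast
      show "A p \<in> L" if "p < d\<^sub>r\<^sub>k" for p using A[OF that] FK by blast
      show "e p j \<in> K" for p j using e[of p j] E by blast
    qed (fact v_eq vanish)+
    then show False
      using product_nonzero[where c = "\<lambda>u. c $ u" and v = "\<lambda>j. v $ j" and b = b,
          OF assms(33,16,19) u0 j0] by blast
  qed
  then show ?thesis
    using ceiling_divide_le_of_le_mult[of "\<delta> + r" d\<^sub>H d\<^sub>r\<^sub>k]
      ceiling_divide_le_of_le_mult[of "\<delta> + r" d\<^sub>r\<^sub>k d\<^sub>H] by (simp add: mult.commute)
qed

end
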